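(* There exists a universal constant $C>0$ such that the following holds for all real numbers $d,A$ satisfying $$0<d<\frac{20}{399},\qquad \sqrt{1+4d^2}<Ad\le 1+\frac{d}{10},$$ and every unit vector $p\in\mathbb R^2$. Let $x_{\mathrm s}:=(\pi,0)$ and $x_{\mathrm f}:=(\pi/2,0)$. For $\varepsilon>0$ set $V_A^\varepsilon(x):=V_A(x/\varepsilon)$ and $d_\varepsilon:=\varepsilon d$, and let $G^{\varepsilon,p}$ be the viscosity solution on $\mathbb R^2\times[0,\infty)$ of $$G_t+\left(1+d_\varepsilon\frac{DG^{\mathsf T}S_{V_A^\varepsilon}(x)DG}{|DG|^2}\right)_+|DG|+V_A^\varepsilon(x)\cdot DG=0,\qquad G(x,0)=p\cdot x,$$ where the Hamiltonian is extended by the value $0$ at zero gradient. Then, for every $t_0>0$, $$\liminf_{\varepsilon\downarrow0}\left[G^{\varepsilon,p}(\varepsilon x_{\mathrm s},t_0)-G^{\varepsilon,p}(\varepsilon x_{\mathrm f},t_0)\right]\ge C\frac{A}{\log A}\,t_0,$$ while $|\varepsilon x_{\mathrm s}-\varepsilon x_{\mathrm f}|=\frac{\pi}{2}\varepsilon$. Consequently, there is no sequence $\varepsilon_j\downarrow0$ for which $G^{\varepsilon_j,p}$ converges locally uniformly on $\mathbb R^2\times[0,\infty)$. In particular, for no unit vector $p$ does $G^{\varepsilon,p}$ converge locally uniformly, as $\varepsilon\downarrow0$, to a solution of a deterministic first order Hamilton-Jacobi equation $\overline G_t+\overline H(D\overline G)=0$, $\overline G(x,0)=p\cdot x$.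
   Context: The cellular flow is $V_0(x_1,x_2)=(-\sin x_1\cos x_2,\ \cos x_1\sin x_2)$ and $V_A=AV_0$. For a $C^1$ vector field $V$, $S_V=(DV+DV^{\mathsf T})/2$. $(a)_+=\max\{a,0\}$. "The viscosity solution" means the unique continuous viscosity solution on $\mathbb R^2\times[0,\infty)$ in the planar periodic class, i.e. such that $G(x,t)-p\cdot x$ is $2\pi\varepsilon\mathbb Z^2$-periodic in $x$. Convention: an upper semicontinuous $G$ is a viscosity subsolution of $G_t+H(x,DG)=0$ if $\varphi_t+H(x_0,D\varphi)\le0$ at $(x_0,t_0)$, $t_0>0$, whenever $\varphi\in C^1$ and $G-\varphi$ has a local maximum at $(x_0,t_0)$; a lower semicontinuous $G$ is a supersolution if the reverse inequality holds at local minima; a solution is both. *)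

theory Defs
  imports "HOL-Analysis.Analysis"
begin

section \<open>Viscosity solutions of first order Hamilton-Jacobi equations\<close>

text \<open>
  Functions of space and time are total functions of a pair \<open>(x, t)\<close>; only their values for
  \<open>t \<ge> 0\<close> are relevant.
\<close>

definition spacetime :: "('a::euclidean_space \<times> real) set" where
  "spacetime = UNIV \<times> {0..}"

definition usc_on :: "'a::topological_space set \<Rightarrow> ('a \<Rightarrow> real) \<Rightarrow> bool" where
  "usc_on S f \<longleftrightarrow> (\<forall>z\<in>S. \<forall>c. f z < c \<longrightarrow> (\<forall>\<^sub>F w in at z within S. f w < c))"

definition lsc_on :: "'a::topological_space set \<Rightarrow> ('a \<Rightarrow> real) \<Rightarrow> bool" where
  "lsc_on S f \<longleftrightarrow> (\<forall>z\<in>S. \<forall>c. c < f z \<longrightarrow> (\<forall>\<^sub>F w in at z within S. c < f w))"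

definition local_max_at :: "('a::topological_space \<Rightarrow> real) \<Rightarrow> 'a \<Rightarrow> bool" where
  "local_max_at f z \<longleftrightarrow> (\<forall>\<^sub>F w in nhds z. f w \<le> f z)"

definition local_min_at :: "('a::topological_space \<Rightarrow> real) \<Rightarrow> 'a \<Rightarrow> bool" where
  "local_min_at f z \<longleftrightarrow> (\<forall>\<^sub>F w in nhds z. f z \<le> f w)"

text \<open>
  \<open>C1_test \<phi> q \<tau>\<close>: the function \<open>\<phi>\<close> is of class \<open>C\<^sup>1\<close> for \<open>t > 0\<close>, with spatial gradient
  \<open>q = D\<phi>\<close> and time derivative \<open>\<tau> = \<phi>\<^sub>t\<close>.
\<close>

definition C1_test ::
  "('a::euclidean_space \<times> real \<Rightarrow> real) \<Rightarrow> ('a \<times> real \<Rightarrow> 'a) \<Rightarrow> ('a \<times> real \<Rightarrow> real) \<Rightarrow> bool" where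
  "C1_test \<phi> q \<tau> \<longleftrightarrow>
     continuous_on (UNIV \<times> {0<..}) q \<and> continuous_on (UNIV \<times> {0<..}) \<tau> \<and>
     (\<forall>z \<in> UNIV \<times> {0<..}. (\<phi> has_derivative (\<lambda>(h, s). q z \<bullet> h + \<tau> z * s)) (at z))"

definition viscosity_subsolution ::
  "('a::euclidean_space \<Rightarrow> 'a \<Rightarrow> real) \<Rightarrow> ('a \<times> real \<Rightarrow> real) \<Rightarrow> bool" where
  "viscosity_subsolution H G \<longleftrightarrow>
     usc_on spacetime G \<and>
     (\<forall>\<phi> q \<tau> x\<^sub>0 t\<^sub>0. C1_test \<phi> q \<tau> \<and> t\<^sub>0 > 0 \<and> local_max_at (\<lambda>z. G z - \<phi> z) (x\<^sub>0, t\<^sub>0) \<longrightarrow>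
        \<tau> (x\<^sub>0, t\<^sub>0) + H x\<^sub>0 (q (x\<^sub>0, t\<^sub>0)) \<le> 0)"

definition viscosity_supersolution ::
  "('a::euclidean_space \<Rightarrow> 'a \<Rightarrow> real) \<Rightarrow> ('a \<times> real \<Rightarrow> real) \<Rightarrow> bool" where
  "viscosity_supersolution H G \<longleftrightarrow>
     lsc_on spacetime G \<and>
     (\<forall>\<phi> q \<tau> x\<^sub>0 t\<^sub>0. C1_test \<phi> q \<tau> \<and> t\<^sub>0 > 0 \<and> local_min_at (\<lambda>z. G z - \<phi> z) (x\<^sub>0, t\<^sub>0) \<longrightarrow>
        \<tau> (x\<^sub>0, t\<^sub>0) + H x\<^sub>0 (q (x\<^sub>0, t\<^sub>0)) \<ge> 0)"

definition viscosity_solution ::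
  "('a::euclidean_space \<Rightarrow> 'a \<Rightarrow> real) \<Rightarrow> ('a \<times> real \<Rightarrow> real) \<Rightarrow> bool" where
  "viscosity_solution H G \<longleftrightarrow> viscosity_subsolution H G \<and> viscosity_supersolution H G"


section \<open>The strain G-equation in the cellular flow\<close>

definition V0 :: "real^2 \<Rightarrow> real^2" where
  "V0 x = vector [- (sin (x$1) * cos (x$2)), cos (x$1) * sin (x$2)]"

definition VA :: "real \<Rightarrow> real^2 \<Rightarrow> real^2" where
  "VA A x = A *\<^sub>R V0 x"

definition VA_scaled :: "real \<Rightarrow> real \<Rightarrow> real^2 \<Rightarrow> real^2" where
  "VA_scaled A \<epsilon> x = VA A (x /\<^sub>R \<epsilon>)"

definition strain :: "(real^'n \<Rightarrow> real^'n) \<Rightarrow> real^'n \<Rightarrow> real^'n^'n" where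
  "strain V x = (1/2) *\<^sub>R (jacobian V (at x) + transpose (jacobian V (at x)))"

definition strain_hamiltonian ::
  "real \<Rightarrow> (real^'n \<Rightarrow> real^'n) \<Rightarrow> real^'n \<Rightarrow> real^'n \<Rightarrow> real" where
  "strain_hamiltonian d V x q =
     (if q = 0 then 0
      else max (1 + d * (q \<bullet> (strain V x *v q)) / (norm q)\<^sup>2) 0 * norm q + V x \<bullet> q)"

text \<open>
  The viscosity solution with initial datum \<open>p \<cdot> x\<close> in the class of functions whose difference
  with \<open>p \<cdot> x\<close> is \<open>2\<pi>\<epsilon>\<int>\<^sup>2\<close>-periodic in \<open>x\<close>; it is unique in this class.
\<close>

definition G_solution ::
  "real \<Rightarrow> real \<Rightarrow> real \<Rightarrow> real^2 \<Rightarrow> ((real^2) \<times> real \<Rightarrow> real) \<Rightarrow> bool" where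
  "G_solution d A \<epsilon> p G \<longleftrightarrow>
     continuous_on spacetime G \<and>
     viscosity_solution (strain_hamiltonian (\<epsilon> * d) (VA_scaled A \<epsilon>)) G \<and>
     (\<forall>x. G (x, 0) = p \<bullet> x) \<and>
     (\<forall>k::int^2. \<forall>x. \<forall>t\<ge>0.
        let y = x + (2 * pi * \<epsilon>) *\<^sub>R (\<chi> i. of_int (k$i))
        in G (y, t) - p \<bullet> y = G (x, t) - p \<bullet> x)"

definition x_s :: "real^2" where
  "x_s = vector [pi, 0]"

definition x_f :: "real^2" where
  "x_f = vector [pi/2, 0]"


section \<open>Locally uniform convergence\<close>

definition locally_uniform_limit ::
  "'a::topological_space set \<Rightarrow> ('b \<Rightarrow> 'a \<Rightarrow> 'c::metric_space) \<Rightarrow> ('a \<Rightarrow> 'c) \<Rightarrow> 'b filter \<Rightarrow> bool" where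
  "locally_uniform_limit S f l F \<longleftrightarrow>
     (\<forall>K. compact K \<and> K \<subseteq> S \<longrightarrow> uniform_limit K f l F)"

end

theory Submission
  imports Defs
begin

text \<open>
  Replacing \<open>G\<close> by \<open>g (x, t) = G (\<epsilon> x, \<epsilon> t) / \<epsilon>\<close> turns the equation into the one with \<open>\<epsilon> = 1\<close>, and the claim
  into a linear lower bound in \<open>T\<close> for \<open>g (x_s, T) - g (x_f, T)\<close>, with errors independent of \<open>\<epsilon>\<close>: the value at
  the stagnation point \<open>x_s\<close> stays bounded below, while the value at \<open>x_f\<close> decreases at a rate of order
  \<open>A / ln A\<close>.

  Boundedness at \<open>x_s\<close>.  The flow near \<open>x_s\<close> contracts in the second direction, so fronts there become
  horizontal, and for these the burning speed \<open>1 - d A cos y\<^sub>1 cos y\<^sub>2\<close> is cut off at zero near \<open>x_s\<close>,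
  where \<open>y = x - x_s\<close>.  Hence a thin unburnt lens survives, provided that its tips \<open>y\<^sub>1 = \<plusminus>a\<close> are pushed outward faster than
  they burn, \<open>A sin a > 1 + d A cos a\<close>, while still \<open>d A cos a > 1\<close>.  Both are possible precisely because
  \<open>sqrt (1 + 4 d\<^sup>2) < A d\<close>.  The lens is the ellipse \<open>y\<^sub>1\<^sup>2 / a\<^sup>2 + y\<^sub>2\<^sup>2 e\<^bsup>2At\<^esup> / b\<^sup>2 < 1\<close>, and a nondecreasing
  \<open>C\<^sup>1\<close> function of its defining function, minus \<open>\<sigma> t\<close>, is a strict subsolution there, which is compared with
  \<open>g\<close> (\<open>supersolution_lower_bound\<close>).

  Decrease at \<open>x_f\<close>.  The Hamiltonian dominates \<open>V \<bullet> q + r |q|\<close> with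
  \<open>r = max 0 (1 - d A |cos x\<^sub>1 cos x\<^sub>2|)\<close>, so \<open>g\<close> does not increase along curves with velocity within distance
  \<open>r\<close> of \<open>V\<close> (\<open>subsolution_le_along_curve\<close>).  From the midpoint of an edge of a cell such a curve first
  leaves the separatrix, using that \<open>r\<close> is bounded below near the midpoint, then follows a streamline of
  stream function value \<open>1 / (5 A)\<close> around the next corner, in time of order \<open>ln A / A\<close>, and reaches the
  midpoint of the next edge; it may turn either way (\<open>quarter_turn\<close>).  Four or eight such turns
  lead from \<open>x_f\<close> to a translate of \<open>x_f\<close> by one period in any of the four lattice directions (\<open>loops\<close>).
  As one of these directions has inner product at least \<open>1/2\<close> with \<open>p\<close>, periodicity of \<open>g - p \<bullet> x\<close> gives
  a decrease by \<open>\<pi>\<close> in each time span of order \<open>ln A / A\<close> (\<open>descent_at_x_f\<close>).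

  A locally uniform limit would be continuous, so the difference of the values at \<open>\<epsilon> x_s\<close> and \<open>\<epsilon> x_f\<close>,
  two points that both tend to \<open>0\<close>, would tend to zero.
\<close>

section \<open>Hyperbolic rescaling of viscosity solutions\<close>

lemma continuous_on_imp_usc_on: "continuous_on S f \<Longrightarrow> usc_on S f"
  unfolding usc_on_def continuous_on_def by (auto intro: order_tendstoD)

lemma continuous_on_imp_lsc_on: "continuous_on S f \<Longrightarrow> lsc_on S f"
  unfolding lsc_on_def continuous_on_def by (auto intro: order_tendstoD)

lemma C1_test_rescale:
  fixes \<phi> :: "'a::euclidean_space \<times> real \<Rightarrow> real"
  assumes "\<epsilon> > 0" and \<phi>: "C1_test \<phi> q \<tau>"
  defines "S \<equiv> \<lambda>z. (fst z /\<^sub>R \<epsilon>, snd z / \<epsilon>)"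
  shows "C1_test (\<lambda>z. \<epsilon> * \<phi> (S z)) (\<lambda>z. q (S z)) (\<lambda>z. \<tau> (S z))"
proof -
  have S: "S z \<in> UNIV \<times> {0<..}" if "z \<in> UNIV \<times> {0<..}" for z
    using that \<open>\<epsilon> > 0\<close> by (auto simp: S_def)
  have contS: "continuous_on (UNIV \<times> {0<..}) S"
    unfolding S_def using \<open>\<epsilon> > 0\<close> by (intro continuous_intros) auto
  have img: "S ` (UNIV \<times> {0<..}) \<subseteq> UNIV \<times> {0<..}"
    using S by blast
  have "continuous_on (UNIV \<times> {0<..}) q" "continuous_on (UNIV \<times> {0<..}) \<tau>"
    using \<phi> by (simp_all add: C1_test_def)
  then have q: "continuous_on (UNIV \<times> {0<..}) (\<lambda>z. q (S z))"
    and \<tau>: "continuous_on (UNIV \<times> {0<..}) (\<lambda>z. \<tau> (S z))"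
    by (auto intro: continuous_on_compose2[OF _ contS img])
  have "((\<lambda>z. \<epsilon> * \<phi> (S z)) has_derivative (\<lambda>(h, s). q (S z) \<bullet> h + \<tau> (S z) * s)) (at z)"
    if z: "z \<in> UNIV \<times> {0<..}" for z
  proof -
    have dS: "(S has_derivative (\<lambda>h. (fst h /\<^sub>R \<epsilon>, snd h / \<epsilon>))) (at z)"
      unfolding S_def using \<open>\<epsilon> > 0\<close> by (auto intro!: derivative_eq_intros)
    have d\<phi>: "(\<phi> has_derivative (\<lambda>(h, s). q (S z) \<bullet> h + \<tau> (S z) * s)) (at (S z))"
      using \<phi> S[OF z] by (auto simp: C1_test_def)
    have "((\<lambda>z. \<epsilon> * \<phi> (S z)) has_derivative
            (\<lambda>h. \<epsilon> * (case (fst h /\<^sub>R \<epsilon>, snd h / \<epsilon>) of (h, s) \<Rightarrow> q (S z) \<bullet> h + \<tau> (S z) * s))) (at z)"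
      by (intro has_derivative_mult_right has_derivative_compose[OF dS d\<phi>])
    also have "(\<lambda>h. \<epsilon> * (case (fst h /\<^sub>R \<epsilon>, snd h / \<epsilon>) of (h, s) \<Rightarrow> q (S z) \<bullet> h + \<tau> (S z) * s))
             = (\<lambda>(h, s). q (S z) \<bullet> h + \<tau> (S z) * s)"
      using \<open>\<epsilon> > 0\<close> by (auto simp: fun_eq_iff field_simps)
    finally show ?thesis .
  qed
  with q \<tau> show ?thesis by (auto simp: C1_test_def)
qed

text \<open>
  The hyperbolic rescaling. If \<open>G\<close> solves the equation with Hamiltonian \<open>H\<close>, then \<open>rescale \<epsilon> G\<close> solves the
  one with Hamiltonian \<open>\<lambda>x. H (\<epsilon> x)\<close>, gradients being unchanged.
\<close>

definition rescale :: "real \<Rightarrow> ('a::euclidean_space \<times> real \<Rightarrow> real) \<Rightarrow> 'a \<times> real \<Rightarrow> real" where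
  "rescale \<epsilon> G = (\<lambda>(x, t). G (\<epsilon> *\<^sub>R x, \<epsilon> * t) / \<epsilon>)"

lemma continuous_on_rescale:
  assumes "\<epsilon> > 0" "continuous_on spacetime G"
  shows "continuous_on spacetime (rescale \<epsilon> G)"
proof -
  have "continuous_on spacetime (\<lambda>z. G (\<epsilon> *\<^sub>R fst z, \<epsilon> * snd z))"
    using assms by (intro continuous_on_compose2[OF assms(2)] continuous_intros)
      (auto simp: spacetime_def)
  then show ?thesis
    using \<open>\<epsilon> > 0\<close> unfolding rescale_def case_prod_beta by (intro continuous_intros) auto
qed

lemma eventually_nhds_rescale:
  fixes x :: "'a::euclidean_space"
  assumes "\<epsilon> > 0" "\<forall>\<^sub>F w in nhds (x, t::real). P w"
  shows "\<forall>\<^sub>F z in nhds (\<epsilon> *\<^sub>R x, \<epsilon> * t). P (fst z /\<^sub>R \<epsilon>, snd z / \<epsilon>)"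
proof -
  have "continuous_on UNIV (\<lambda>z::'a \<times> real. (fst z /\<^sub>R \<epsilon>, snd z / \<epsilon>))"
    using \<open>\<epsilon> > 0\<close> by (intro continuous_intros) auto
  then have "isCont (\<lambda>z::'a \<times> real. (fst z /\<^sub>R \<epsilon>, snd z / \<epsilon>)) (\<epsilon> *\<^sub>R x, \<epsilon> * t)"
    by (simp add: continuous_on_eq_continuous_at)
  then have "filterlim (\<lambda>z::'a \<times> real. (fst z /\<^sub>R \<epsilon>, snd z / \<epsilon>)) (nhds (x, t)) (nhds (\<epsilon> *\<^sub>R x, \<epsilon> * t))"
    using \<open>\<epsilon> > 0\<close> unfolding isCont_def
    by (subst (asm) tendsto_at_iff_tendsto_nhds) simp
  with assms(2) show ?thesis by (simp add: filterlim_iff)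
qed

lemma viscosity_subsolution_rescale:
  assumes "\<epsilon> > 0" and G: "viscosity_subsolution H G" and cont: "continuous_on spacetime G"
  shows "viscosity_subsolution (\<lambda>x. H (\<epsilon> *\<^sub>R x)) (rescale \<epsilon> G)"
  unfolding viscosity_subsolution_def
proof (intro conjI allI impI)
  show "usc_on spacetime (rescale \<epsilon> G)"
    by (intro continuous_on_imp_usc_on continuous_on_rescale assms)
  fix \<phi> q \<tau> x t
  assume *: "C1_test \<phi> q \<tau> \<and> 0 < t \<and> local_max_at (\<lambda>z. rescale \<epsilon> G z - \<phi> z) (x, t)"
  have "\<forall>\<^sub>F z in nhds (\<epsilon> *\<^sub>R x, \<epsilon> * t).
      G z - \<epsilon> * \<phi> (fst z /\<^sub>R \<epsilon>, snd z / \<epsilon>) \<le> G (\<epsilon> *\<^sub>R x, \<epsilon> * t) - \<epsilon> * \<phi> (x, t)"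
  proof (rule eventually_mono[OF eventually_nhds_rescale[OF \<open>\<epsilon> > 0\<close>]])
    show "\<forall>\<^sub>F w in nhds (x, t). rescale \<epsilon> G w - \<phi> w \<le> rescale \<epsilon> G (x, t) - \<phi> (x, t)"
      using * by (simp add: local_max_at_def)
  next
    fix z
    assume "rescale \<epsilon> G (fst z /\<^sub>R \<epsilon>, snd z / \<epsilon>) - \<phi> (fst z /\<^sub>R \<epsilon>, snd z / \<epsilon>)
      \<le> rescale \<epsilon> G (x, t) - \<phi> (x, t)"
    from mult_left_mono[OF this, of \<epsilon>] \<open>\<epsilon> > 0\<close> show "G z - \<epsilon> * \<phi> (fst z /\<^sub>R \<epsilon>, snd z / \<epsilon>)
      \<le> G (\<epsilon> *\<^sub>R x, \<epsilon> * t) - \<epsilon> * \<phi> (x, t)"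
      by (simp add: rescale_def right_diff_distrib)
  qed
  then have "local_max_at (\<lambda>z. G z - \<epsilon> * \<phi> (fst z /\<^sub>R \<epsilon>, snd z / \<epsilon>)) (\<epsilon> *\<^sub>R x, \<epsilon> * t)"
    using \<open>\<epsilon> > 0\<close> by (simp add: local_max_at_def)
  then have "C1_test (\<lambda>z. \<epsilon> * \<phi> (fst z /\<^sub>R \<epsilon>, snd z / \<epsilon>)) (\<lambda>z. q (fst z /\<^sub>R \<epsilon>, snd z / \<epsilon>))
        (\<lambda>z. \<tau> (fst z /\<^sub>R \<epsilon>, snd z / \<epsilon>)) \<and> 0 < \<epsilon> * t \<and>
      local_max_at (\<lambda>z. G z - \<epsilon> * \<phi> (fst z /\<^sub>R \<epsilon>, snd z / \<epsilon>)) (\<epsilon> *\<^sub>R x, \<epsilon> * t)"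
    using C1_test_rescale[OF \<open>\<epsilon> > 0\<close> conjunct1[OF *]] * \<open>\<epsilon> > 0\<close> by simp
  from conjunct2[OF G[unfolded viscosity_subsolution_def], rule_format, OF this]
  show "\<tau> (x, t) + H (\<epsilon> *\<^sub>R x) (q (x, t)) \<le> 0"
    using \<open>\<epsilon> > 0\<close> by simp
qed

lemma viscosity_supersolution_rescale:
  assumes "\<epsilon> > 0" and G: "viscosity_supersolution H G" and cont: "continuous_on spacetime G"
  shows "viscosity_supersolution (\<lambda>x. H (\<epsilon> *\<^sub>R x)) (rescale \<epsilon> G)"
  unfolding viscosity_supersolution_def
proof (intro conjI allI impI)
  show "lsc_on spacetime (rescale \<epsilon> G)"
    by (intro continuous_on_imp_lsc_on continuous_on_rescale assms)
  fix \<phi> q \<tau> x t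
  assume *: "C1_test \<phi> q \<tau> \<and> 0 < t \<and> local_min_at (\<lambda>z. rescale \<epsilon> G z - \<phi> z) (x, t)"
  have "\<forall>\<^sub>F z in nhds (\<epsilon> *\<^sub>R x, \<epsilon> * t).
      G (\<epsilon> *\<^sub>R x, \<epsilon> * t) - \<epsilon> * \<phi> (x, t) \<le> G z - \<epsilon> * \<phi> (fst z /\<^sub>R \<epsilon>, snd z / \<epsilon>)"
  proof (rule eventually_mono[OF eventually_nhds_rescale[OF \<open>\<epsilon> > 0\<close>]])
    show "\<forall>\<^sub>F w in nhds (x, t). rescale \<epsilon> G (x, t) - \<phi> (x, t) \<le> rescale \<epsilon> G w - \<phi> w"
      using * by (simp add: local_min_at_def)
  next
    fix z
    assume "rescale \<epsilon> G (x, t) - \<phi> (x, t)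
      \<le> rescale \<epsilon> G (fst z /\<^sub>R \<epsilon>, snd z / \<epsilon>) - \<phi> (fst z /\<^sub>R \<epsilon>, snd z / \<epsilon>)"
    from mult_left_mono[OF this, of \<epsilon>] \<open>\<epsilon> > 0\<close> show "G (\<epsilon> *\<^sub>R x, \<epsilon> * t) - \<epsilon> * \<phi> (x, t)
      \<le> G z - \<epsilon> * \<phi> (fst z /\<^sub>R \<epsilon>, snd z / \<epsilon>)"
      by (simp add: rescale_def right_diff_distrib)
  qed
  then have "local_min_at (\<lambda>z. G z - \<epsilon> * \<phi> (fst z /\<^sub>R \<epsilon>, snd z / \<epsilon>)) (\<epsilon> *\<^sub>R x, \<epsilon> * t)"
    using \<open>\<epsilon> > 0\<close> by (simp add: local_min_at_def)
  then have "C1_test (\<lambda>z. \<epsilon> * \<phi> (fst z /\<^sub>R \<epsilon>, snd z / \<epsilon>)) (\<lambda>z. q (fst z /\<^sub>R \<epsilon>, snd z / \<epsilon>))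
        (\<lambda>z. \<tau> (fst z /\<^sub>R \<epsilon>, snd z / \<epsilon>)) \<and> 0 < \<epsilon> * t \<and>
      local_min_at (\<lambda>z. G z - \<epsilon> * \<phi> (fst z /\<^sub>R \<epsilon>, snd z / \<epsilon>)) (\<epsilon> *\<^sub>R x, \<epsilon> * t)"
    using C1_test_rescale[OF \<open>\<epsilon> > 0\<close> conjunct1[OF *]] * \<open>\<epsilon> > 0\<close> by simp
  from conjunct2[OF G[unfolded viscosity_supersolution_def], rule_format, OF this]
  show "\<tau> (x, t) + H (\<epsilon> *\<^sub>R x) (q (x, t)) \<ge> 0"
    using \<open>\<epsilon> > 0\<close> by simp
qed

section \<open>The strain Hamiltonian of the cellular flow\<close>

text \<open>
  The Hamiltonian for \<open>\<epsilon> = 1\<close> in coordinates. The strain matrix of \<open>V\<^sub>A\<close> is diagonal, with entries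
  \<open>\<mp>A cos x\<^sub>1 cos x\<^sub>2\<close>.
\<close>

definition cell_hamiltonian :: "real \<Rightarrow> real \<Rightarrow> real^2 \<Rightarrow> real^2 \<Rightarrow> real" where
  "cell_hamiltonian d A x q =
     (if q = 0 then 0
      else max (1 + d * A * cos (x$1) * cos (x$2) * ((q$2)\<^sup>2 - (q$1)\<^sup>2) / (norm q)\<^sup>2) 0 * norm q
        + VA A x \<bullet> q)"

lemma norm_vec2_sq: "(norm (q::real^2))\<^sup>2 = (q$1)\<^sup>2 + (q$2)\<^sup>2"
  by (simp only: power2_norm_eq_inner) (simp add: inner_vec_def sum_2 power2_eq_square)

lemma inner_vec2: "(p::real^2) \<bullet> q = p$1 * q$1 + p$2 * q$2"
  by (simp add: inner_vec_def sum_2)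

lemma VA_nth [simp]:
  "VA A x $ 1 = - (A * (sin (x$1) * cos (x$2)))" "VA A x $ 2 = A * (cos (x$1) * sin (x$2))"
  by (simp_all add: VA_def V0_def)

text \<open>
  The antisymmetric part of the Jacobian does not contribute to the quadratic form of the strain.
\<close>

lemma inner_strain:
  assumes "(V has_derivative D) (at x)"
  shows "q \<bullet> (strain V x *v q) = q \<bullet> D q"
proof -
  have J: "jacobian V (at x) *v h = D h" for h
    using assms
    by (simp add: jacobian_def frechet_derivative_at[symmetric] matrix_works has_derivative_linear)
  have "q \<bullet> (transpose (jacobian V (at x)) *v q) = q \<bullet> (jacobian V (at x) *v q)"
    by (metis dot_lmul_matrix inner_commute transpose_matrix_vector)
  then show ?thesis
    by (simp add: strain_def scaleR_matrix_vector_assoc[symmetric]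
        matrix_vector_mult_add_rdistrib inner_add_right J)
qed

lemma VA_scaled_has_derivative:
  assumes "\<epsilon> > 0"
  defines "y \<equiv> \<lambda>x. x /\<^sub>R \<epsilon>"
  shows "(VA_scaled A \<epsilon> has_derivative
     (\<lambda>h. vector [(A / \<epsilon>) * (- cos (y x$1) * cos (y x$2) * h$1 + sin (y x$1) * sin (y x$2) * h$2),
                  (A / \<epsilon>) * (- sin (y x$1) * sin (y x$2) * h$1 + cos (y x$1) * cos (y x$2) * h$2)]))
     (at x)"
proof (subst has_derivative_componentwise_within, intro ballI)
  fix i :: "real^2" assume "i \<in> Basis"
  then obtain k where i: "i = axis k 1" by (auto simp: Basis_vec_def)
  have [derivative_intros]: "((\<lambda>x. x $ j) has_derivative (\<lambda>h. h $ j)) (at x)" for x :: "real^2" and j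
    by (rule bounded_linear_imp_has_derivative) (rule bounded_linear_vec_nth)
  show "((\<lambda>x. VA_scaled A \<epsilon> x \<bullet> i) has_derivative
     (\<lambda>h. vector [(A / \<epsilon>) * (- cos (y x$1) * cos (y x$2) * h$1 + sin (y x$1) * sin (y x$2) * h$2),
                  (A / \<epsilon>) * (- sin (y x$1) * sin (y x$2) * h$1 + cos (y x$1) * cos (y x$2) * h$2)] \<bullet> i))
     (at x)"
    using exhaust_2[of k] \<open>\<epsilon> > 0\<close>
    by (auto simp: i inner_axis VA_scaled_def y_def fun_eq_iff field_simps
        intro!: derivative_eq_intros)
qed

lemma strain_hamiltonian_VA_scaled:
  assumes "\<epsilon> > 0"
  shows "strain_hamiltonian (\<epsilon> * d) (VA_scaled A \<epsilon>) (\<epsilon> *\<^sub>R x) q = cell_hamiltonian d A x q"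
proof -
  have *: "\<epsilon> * d * (q \<bullet> (strain (VA_scaled A \<epsilon>) (\<epsilon> *\<^sub>R x) *v q))
      = d * A * cos (x$1) * cos (x$2) * ((q$2)\<^sup>2 - (q$1)\<^sup>2)"
    using assms
    by (subst inner_strain[OF VA_scaled_has_derivative])
       (auto simp: inner_vec2 field_simps power2_eq_square)
  have "VA_scaled A \<epsilon> (\<epsilon> *\<^sub>R x) = VA A x"
    using assms by (simp add: VA_scaled_def)
  then show ?thesis
    unfolding strain_hamiltonian_def cell_hamiltonian_def * by simp
qed

section \<open>Subsolutions along controlled curves\<close>

lemma C1_test_quadratic:
  fixes x0 :: "'a::euclidean_space"
  shows "C1_test (\<lambda>z. k * ((norm (fst z - x0))\<^sup>2 + (snd z - t0)\<^sup>2))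
           (\<lambda>z. (2 * k) *\<^sub>R (fst z - x0)) (\<lambda>z. 2 * k * (snd z - t0))"
  unfolding C1_test_def
proof (intro conjI ballI)
  fix z :: "'a \<times> real"
  show "((\<lambda>z. k * ((norm (fst z - x0))\<^sup>2 + (snd z - t0)\<^sup>2)) has_derivative
     (\<lambda>(h, s). ((2 * k) *\<^sub>R (fst z - x0)) \<bullet> h + 2 * k * (snd z - t0) * s)) (at z)"
    unfolding power2_norm_eq_inner
    by (auto intro!: derivative_eq_intros simp: fun_eq_iff algebra_simps inner_commute)
qed (intro continuous_intros)+

lemma left_derivative_nonneg_at_max:
  fixes f :: "real \<Rightarrow> real"
  assumes "(f has_real_derivative D) (at b within {a..c})" "a < b" "b \<le> c"
    and "\<And>s. s \<in> {a..c} \<Longrightarrow> f s \<le> f b"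
  shows "0 \<le> D"
proof (rule ccontr)
  assume "\<not> 0 \<le> D"
  then obtain e where e: "e > 0" "\<And>h. 0 < h \<Longrightarrow> b - h \<in> {a..c} \<Longrightarrow> h < e \<Longrightarrow> f b < f (b - h)"
    using has_real_derivative_neg_dec_left[OF assms(1)] by force
  define h where "h = min (e/2) (b - a)"
  have "0 < h" "h < e" "b - h \<in> {a..c}"
    using e(1) assms(2,3) by (auto simp: h_def min_def)
  with e(2)[of h] assms(4)[of "b - h"] show False by fastforce
qed

text \<open>
  A subsolution whose Hamiltonian dominates \<open>V \<bullet> q + r |q|\<close> does not increase along space-time curves
  \<open>s \<mapsto> (\<gamma> s, \<theta> s)\<close> with \<open>|\<gamma>' - \<theta>' V| \<le> \<theta>' r\<close>. The time \<open>\<theta>\<close> need not be the parameter, so no differential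
  equation has to be solved to obtain such curves.
  
  If the claim fails, maximise \<open>g (x, t) - k (|x - \<gamma> s|\<^sup>2 + |t - \<theta> s|\<^sup>2) - \<sigma> \<theta> s\<close> over \<open>x\<close>, \<open>t\<close> and \<open>s\<close>. The
  subsolution property at the maximiser contradicts maximality in \<open>s\<close> once \<open>k\<close> is large, since
  \<open>k |x - \<gamma> s|\<^sup>2\<close> is then small compared with \<open>\<sigma>\<close>. A maximum at the end \<open>s = b\<close> does no harm, because only the
  left derivative is used.
\<close>

lemma subsolution_le_along_curve_pos:
  fixes g :: "'a::euclidean_space \<times> real \<Rightarrow> real"
  assumes cont: "continuous_on spacetime g"
    and sub: "viscosity_subsolution H g"
    and H: "\<And>x q. V x \<bullet> q + r x * norm q \<le> H x q"
    and V: "\<And>x y. norm (V x - V y) \<le> L * norm (x - y)"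
    and r: "\<And>x y. \<bar>r x - r y\<bar> \<le> L * norm (x - y)"
    and ab: "a \<le> b"
    and \<gamma>: "\<And>s. s \<in> {a..b} \<Longrightarrow> (\<gamma> has_vector_derivative \<gamma>' s) (at s within {a..b})"
    and \<theta>: "\<And>s. s \<in> {a..b} \<Longrightarrow> (\<theta> has_real_derivative \<theta>' s) (at s within {a..b})"
    and \<theta>': "\<And>s. s \<in> {a..b} \<Longrightarrow> \<theta>' s > 0"
    and adm: "\<And>s. s \<in> {a..b} \<Longrightarrow> norm (\<gamma>' s - \<theta>' s *\<^sub>R V (\<gamma> s)) \<le> \<theta>' s * r (\<gamma> s)"
    and pos: "\<theta> a > 0"
  shows "g (\<gamma> b, \<theta> b) \<le> g (\<gamma> a, \<theta> a)"
proof (rule ccontr)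
  assume increase: "\<not> ?thesis"
  define \<kappa> where "\<kappa> = (g (\<gamma> b, \<theta> b) - g (\<gamma> a, \<theta> a)) / 2"
  have \<kappa>: "\<kappa> > 0" using increase by (simp add: \<kappa>_def)
  have \<theta>_mono: "\<theta> a \<le> \<theta> s" if "s \<in> {a..b}" for s
  proof -
    have "\<exists>x\<in>{a..s}. \<theta> s - \<theta> a = (\<lambda>h. \<theta>' x * h) (s - a)"
      using that \<theta> has_field_derivative_subset[OF \<theta>, of _ "{a..s}"]
      by (intro mvt_very_simple) (auto simp: has_field_derivative_def)
    then show ?thesis
      using that \<theta>' by (smt (verit) atLeastAtMost_iff mult_nonneg_nonneg order_trans)
  qed
  define \<sigma> where "\<sigma> = \<kappa> / (\<theta> b + 1)"
  have "\<theta> b > 0" using \<theta>_mono[of b] ab pos by auto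
  then have \<sigma>: "\<sigma> > 0" "\<sigma> * \<theta> b < \<kappa>"
    using \<kappa> by (auto simp: \<sigma>_def field_simps)
  have cont\<gamma>: "continuous_on {a..b} \<gamma>"
    using \<gamma> by (meson has_vector_derivative_continuous continuous_on_eq_continuous_within)
  have cont\<theta>: "continuous_on {a..b} \<theta>"
    using \<theta> by (meson DERIV_continuous continuous_on_eq_continuous_within)
  obtain R1 where R1: "\<And>s. s \<in> {a..b} \<Longrightarrow> norm (\<gamma> s) \<le> R1"
    using compact_imp_bounded[OF compact_continuous_image[OF cont\<gamma> compact_Icc]]
    unfolding bounded_iff by blast
  obtain R2 where R2: "\<And>s. s \<in> {a..b} \<Longrightarrow> norm (\<theta> s) \<le> R2"
    using compact_imp_bounded[OF compact_continuous_image[OF cont\<theta> compact_Icc]]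
    unfolding bounded_iff by blast
  define K where "K = cball (0::'a) (R1 + 1) \<times> {0..R2 + 1}"
  have K: "compact K" "K \<subseteq> spacetime"
    by (auto simp: K_def spacetime_def intro: compact_Times)
  have gK: "continuous_on K g" using cont K(2) by (rule continuous_on_subset)
  have curveK: "(\<gamma> s, \<theta> s) \<in> K" if "s \<in> {a..b}" for s
    using R1[OF that] R2[OF that] \<theta>_mono[OF that] pos by (auto simp: K_def)
  obtain B where B: "\<And>z. z \<in> K \<Longrightarrow> \<bar>g z\<bar> \<le> B"
    using compact_imp_bounded[OF compact_continuous_image[OF gK K(1)]]
    by (auto simp: bounded_iff)
  define \<omega> where "\<omega> = min \<kappa> (\<sigma> / (4 * (\<bar>L\<bar> + 1)))"
  have \<omega>: "\<omega> > 0" using \<kappa> \<sigma> by (auto simp: \<omega>_def)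
  obtain \<rho> where \<rho>: "\<rho> > 0" "\<And>z w. z \<in> K \<Longrightarrow> w \<in> K \<Longrightarrow> dist w z < \<rho> \<Longrightarrow> dist (g w) (g z) < \<omega>"
    using compact_uniformly_continuous[OF gK K(1)] \<omega> unfolding uniformly_continuous_on_def by metis
  define \<rho>' where "\<rho>' = Min {\<rho>, \<theta> a, 1}"
  have \<rho>': "\<rho>' > 0" "\<rho>' \<le> \<rho>" "\<rho>' \<le> \<theta> a" "\<rho>' \<le> 1"
    using \<rho>(1) pos by (auto simp: \<rho>'_def)
  \<comment> \<open>the penalisation parameter is large enough to confine the maximiser to the \<open>\<rho>'\<close>-tube\<close>
  define k where "k = (2 * \<bar>B\<bar> + 1) / \<rho>'\<^sup>2"
  have k: "k > 0" using \<rho>' by (auto simp: k_def)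
  define pen where "pen = (\<lambda>(z, s). k * ((norm (fst z - \<gamma> s))\<^sup>2 + (snd z - \<theta> s)\<^sup>2))"
  define F where "F = (\<lambda>(z, s). g z - pen (z, s) - \<sigma> * \<theta> s)"
  have "continuous_on (K \<times> {a..b}) F"
    unfolding F_def pen_def case_prod_beta
    by (intro continuous_intros continuous_on_compose2[OF gK] continuous_on_compose2[OF cont\<gamma>]
        continuous_on_compose2[OF cont\<theta>]) auto
  moreover have "compact (K \<times> {a..b})" "K \<times> {a..b} \<noteq> {}"
    using K(1) ab curveK[of a] by (auto intro: compact_Times)
  ultimately obtain zs where zs: "zs \<in> K \<times> {a..b}" "\<And>w. w \<in> K \<times> {a..b} \<Longrightarrow> F w \<le> F zs"
    using continuous_attains_sup by metis
  obtain x t s where zs_eq: "zs = ((x, t), s)" by (metis surj_pair)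
  have xt: "(x, t) \<in> K" and s: "s \<in> {a..b}" using zs(1) by (auto simp: zs_eq)
  have max: "F ((y, u), v) \<le> F ((x, t), s)" if "(y, u) \<in> K" "v \<in> {a..b}" for y u v
    using zs(2)[of "((y, u), v)"] that by (simp add: zs_eq)
  have pen_le: "pen ((x, t), s) \<le> g (x, t) - g (\<gamma> s, \<theta> s)"
    using max[OF curveK[OF s] s] by (simp add: F_def pen_def)
  also have "\<dots> \<le> 2 * \<bar>B\<bar>"
    using B[OF xt] B[OF curveK[OF s]] by linarith
  also have "\<dots> < k * \<rho>'\<^sup>2"
    using \<rho>' by (simp add: k_def)
  finally have tube: "(norm (x - \<gamma> s))\<^sup>2 + (t - \<theta> s)\<^sup>2 < \<rho>'\<^sup>2"
    using k by (simp add: pen_def)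
  then have "dist (x, t) (\<gamma> s, \<theta> s) < \<rho>'"
    using \<rho>' by (simp add: dist_norm norm_Pair real_less_lsqrt)
  with \<rho>' have d: "dist (x, t) (\<gamma> s, \<theta> s) < \<rho>" by simp
  have nx: "norm (x - \<gamma> s) < \<rho>'"
    using tube \<rho>' by (smt (verit) power2_less_imp_less zero_le_power2)
  have nt: "\<bar>t - \<theta> s\<bar> < \<rho>'"
  proof (rule power2_less_imp_less)
    have "(t - \<theta> s)\<^sup>2 < \<rho>'\<^sup>2"
      using tube zero_le_power2[of "norm (x - \<gamma> s)"] by linarith
    then show "\<bar>t - \<theta> s\<bar>\<^sup>2 < \<rho>'\<^sup>2" by (simp only: power2_abs)
  qed (use \<rho>' in linarith)
  have osc: "g (x, t) - g (\<gamma> s, \<theta> s) < \<omega>"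
    using \<rho>(2)[OF curveK[OF s] xt d] by (simp add: dist_real_def)
  have "s \<noteq> a"
  proof
    assume "s = a"
    have "g (\<gamma> b, \<theta> b) - \<sigma> * \<theta> b \<le> F ((x, t), s)"
      using max[OF curveK, of b b] ab by (simp add: F_def pen_def)
    also have "\<dots> \<le> g (x, t)"
    proof -
      have "0 \<le> pen ((x, t), a)" "0 \<le> \<sigma> * \<theta> a" using k \<sigma> pos by (simp_all add: pen_def)
      then show ?thesis by (simp add: F_def \<open>s = a\<close>)
    qed
    also have "\<dots> < g (\<gamma> a, \<theta> a) + \<kappa>"
      using osc by (simp add: \<omega>_def \<open>s = a\<close>)
    finally show False using \<sigma>(2) by (simp add: \<kappa>_def field_simps)
  qed
  then have as: "a < s" using s by auto
  have t: "0 < t" using nt \<theta>_mono[OF s] \<rho>' by linarith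
  define P where "P = (2 * k) *\<^sub>R (x - \<gamma> s)"
  define T where "T = 2 * k * (t - \<theta> s)"
  \<comment> \<open>the left derivative in the curve parameter, which has this sign also at \<open>s = b\<close>\<close>
  have "0 \<le> P \<bullet> \<gamma>' s + T * \<theta>' s - \<sigma> * \<theta>' s"
  proof (rule left_derivative_nonneg_at_max)
    show "((\<lambda>v. F ((x, t), v)) has_real_derivative P \<bullet> \<gamma>' s + T * \<theta>' s - \<sigma> * \<theta>' s)
        (at s within {a..b})"
      using \<gamma>[OF s] \<theta>[OF s]
      unfolding F_def pen_def has_vector_derivative_def has_field_derivative_def
        power2_norm_eq_inner case_prod_beta
      by (auto intro!: derivative_eq_intros
          simp: fun_eq_iff algebra_simps inner_commute P_def T_def)
    show "F ((x, t), v) \<le> F ((x, t), s)" if "v \<in> {a..b}" for v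
      by (rule max[OF xt that])
  qed (use as s in auto)
  \<comment> \<open>the penalty with \<open>s\<close> frozen is a test function touching \<open>g\<close> at \<open>(x, t)\<close>\<close>
  have "T + H x P \<le> 0"
  proof -
    have int: "(x, t) \<in> ball 0 (R1 + 1) \<times> {0<..<R2 + 1}"
    proof -
      have "norm x \<le> norm (x - \<gamma> s) + norm (\<gamma> s)"
        by (metis diff_add_cancel norm_triangle_ineq)
      then show ?thesis
        using R1[OF s] R2[OF s] nx nt t \<rho>' by auto
    qed
    have "\<forall>\<^sub>F w in nhds (x, t). w \<in> ball 0 (R1 + 1) \<times> {0<..<R2 + 1}"
      using int by (intro eventually_nhds_in_open open_Times) auto
    then have "\<forall>\<^sub>F w in nhds (x, t). g w - pen (w, s) \<le> g (x, t) - pen ((x, t), s)"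
    proof eventually_elim
      case (elim w)
      then have "w \<in> K" by (auto simp: K_def)
      then show ?case using max[of "fst w" "snd w" s] s by (simp add: F_def)
    qed
    then have "local_max_at (\<lambda>w. g w - k * ((norm (fst w - \<gamma> s))\<^sup>2 + (snd w - \<theta> s)\<^sup>2)) (x, t)"
      by (simp add: local_max_at_def pen_def)
    with sub t C1_test_quadratic[of k "\<gamma> s" "\<theta> s"] show ?thesis
      unfolding viscosity_subsolution_def P_def T_def by fastforce
  qed
  with H[of x P] have subineq: "T + V x \<bullet> P + r x * norm P \<le> 0" by linarith
  have "P \<bullet> (\<gamma>' s - \<theta>' s *\<^sub>R V (\<gamma> s)) \<le> norm P * (\<theta>' s * r (\<gamma> s))"
    using adm[OF s] by (meson Cauchy_Schwarz_ineq2 abs_ge_self mult_left_mono norm_ge_zero order_trans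
        norm_cauchy_schwarz)
  then have "P \<bullet> \<gamma>' s \<le> \<theta>' s * (V (\<gamma> s) \<bullet> P + r (\<gamma> s) * norm P)"
    by (simp add: inner_diff_right algebra_simps inner_commute)
  with \<open>0 \<le> P \<bullet> \<gamma>' s + T * \<theta>' s - \<sigma> * \<theta>' s\<close>
  have "0 \<le> \<theta>' s * (V (\<gamma> s) \<bullet> P + r (\<gamma> s) * norm P + T - \<sigma>)"
    by (simp add: algebra_simps)
  then have "\<sigma> \<le> V (\<gamma> s) \<bullet> P + r (\<gamma> s) * norm P + T"
    using \<theta>'[OF s] by (simp add: zero_le_mult_iff)
  also have "\<dots> \<le> (V (\<gamma> s) - V x) \<bullet> P + (r (\<gamma> s) - r x) * norm P"
    using subineq by (simp add: inner_diff_left algebra_simps)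
  also have "\<dots> \<le> norm (V (\<gamma> s) - V x) * norm P + \<bar>r (\<gamma> s) - r x\<bar> * norm P"
    by (intro add_mono norm_cauchy_schwarz mult_right_mono) auto
  also have "\<dots> \<le> L * norm (\<gamma> s - x) * norm P + L * norm (\<gamma> s - x) * norm P"
    by (intro add_mono mult_right_mono V r) auto
  also have "\<dots> = 4 * L * (k * (norm (x - \<gamma> s))\<^sup>2)"
    using k by (simp add: P_def norm_minus_commute power2_eq_square)
  also have "\<dots> \<le> 4 * (\<bar>L\<bar> + 1) * pen ((x, t), s)"
    using k by (intro mult_mono[of "4 * L"]) (auto simp: pen_def)
  also have "\<dots> < 4 * (\<bar>L\<bar> + 1) * \<omega>"
    using pen_le osc by (intro mult_strict_left_mono) auto
  also have "\<dots> \<le> \<sigma>"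
  proof -
    have "\<omega> \<le> \<sigma> / (4 * (\<bar>L\<bar> + 1))" by (simp add: \<omega>_def)
    then have "\<omega> * (4 * (\<bar>L\<bar> + 1)) \<le> \<sigma>" by (subst (asm) pos_le_divide_eq) auto
    then show ?thesis by (simp only: mult.commute)
  qed
  finally show False by simp
qed

text \<open>
  Curves starting at time \<open>0\<close> are reached by shifting them in time, as \<open>g\<close> is continuous.
\<close>

lemma subsolution_le_along_curve:
  fixes g :: "'a::euclidean_space \<times> real \<Rightarrow> real"
  assumes cont: "continuous_on spacetime g"
    and sub: "viscosity_subsolution H g"
    and H: "\<And>x q. V x \<bullet> q + r x * norm q \<le> H x q"
    and V: "\<And>x y. norm (V x - V y) \<le> L * norm (x - y)"
    and r: "\<And>x y. \<bar>r x - r y\<bar> \<le> L * norm (x - y)"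
    and ab: "a \<le> b"
    and \<gamma>: "\<And>s. s \<in> {a..b} \<Longrightarrow> (\<gamma> has_vector_derivative \<gamma>' s) (at s within {a..b})"
    and \<theta>: "\<And>s. s \<in> {a..b} \<Longrightarrow> (\<theta> has_real_derivative \<theta>' s) (at s within {a..b})"
    and \<theta>': "\<And>s. s \<in> {a..b} \<Longrightarrow> \<theta>' s > 0"
    and adm: "\<And>s. s \<in> {a..b} \<Longrightarrow> norm (\<gamma>' s - \<theta>' s *\<^sub>R V (\<gamma> s)) \<le> \<theta>' s * r (\<gamma> s)"
    and nonneg: "\<theta> a \<ge> 0" "\<theta> b \<ge> 0"
  shows "g (\<gamma> b, \<theta> b) \<le> g (\<gamma> a, \<theta> a)"
proof -
  have lim: "((\<lambda>h. g (y, u + h)) \<longlongrightarrow> g (y, u)) (at_right 0)" if "u \<ge> 0" for y u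
  proof -
    have "continuous_on {0..} (\<lambda>h. g (y, u + h))"
      using that by (intro continuous_on_compose2[OF cont] continuous_intros)
        (auto simp: spacetime_def)
    then have "((\<lambda>h. g (y, u + h)) \<longlongrightarrow> g (y, u + 0)) (at 0 within {0..})"
      unfolding continuous_on_def by (rule bspec) simp
    then have "((\<lambda>h. g (y, u + h)) \<longlongrightarrow> g (y, u + 0)) (at_right 0)"
      by (rule tendsto_within_subset) auto
    then show ?thesis by simp
  qed
  have "g (\<gamma> b, \<theta> b + h) \<le> g (\<gamma> a, \<theta> a + h)" if "h > 0" for h
    using nonneg that \<theta> \<theta>' adm
    by (intro subsolution_le_along_curve_pos[OF cont sub H V r ab \<gamma>, where \<theta>' = \<theta>'])
       (auto intro!: derivative_eq_intros)
  then have "\<forall>\<^sub>F h in at_right 0. g (\<gamma> b, \<theta> b + h) \<le> g (\<gamma> a, \<theta> a + h)"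
    by (simp add: eventually_at_filter)
  then show ?thesis
    by (rule tendsto_le[OF trivial_limit_at_right_real lim[OF nonneg(1)] lim[OF nonneg(2)]])
qed

section \<open>A barrier at the hyperbolic stagnation point\<close>

lemma cell_hamiltonian_scaleR:
  assumes "c \<ge> 0"
  shows "cell_hamiltonian d A x (c *\<^sub>R q) = c * cell_hamiltonian d A x q"
proof (cases "c = 0 \<or> q = 0")
  case False
  then have "c > 0" "q \<noteq> 0" using assms by auto
  then have "(((c *\<^sub>R q)$2)\<^sup>2 - ((c *\<^sub>R q)$1)\<^sup>2) / (norm (c *\<^sub>R q))\<^sup>2 = ((q$2)\<^sup>2 - (q$1)\<^sup>2) / (norm q)\<^sup>2"
    by (simp add: power_mult_distrib right_diff_distrib[symmetric])
  then have "d * A * cos (x$1) * cos (x$2) * (((c *\<^sub>R q)$2)\<^sup>2 - ((c *\<^sub>R q)$1)\<^sup>2) / (norm (c *\<^sub>R q))\<^sup>2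
      = d * A * cos (x$1) * cos (x$2) * ((q$2)\<^sup>2 - (q$1)\<^sup>2) / (norm q)\<^sup>2"
    by (metis times_divide_eq_right)
  with \<open>c > 0\<close> \<open>q \<noteq> 0\<close> show ?thesis
    unfolding cell_hamiltonian_def by (simp add: distrib_left mult.commute mult.left_commute)
qed (auto simp: cell_hamiltonian_def)

text \<open>
  The dimensions of the lens: its half axes \<open>a\<close> and \<open>b\<close>, and a part \<open>a\<^sub>1 \<le> |y\<^sub>1| \<le> a\<close> near the tips in which
  the outward drift beats the burning speed. This is where the lower bound on \<open>A d\<close> enters: at
  \<open>cos a = 1 / (A d)\<close> the tip condition \<open>1 + d A cos a < A sin a\<close> reads \<open>2 < A sin a\<close>, that is
  \<open>1 + 4 d\<^sup>2 < (A d)\<^sup>2\<close>.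
\<close>

lemma barrier_parameters:
  fixes d A :: real
  assumes d: "0 < d" and Ad: "sqrt (1 + 4 * d\<^sup>2) < A * d"
  obtains a1 a b \<eta> where "0 < a1" "a1 < a" "a < pi/2" "0 < b" "b \<le> 1" "0 < \<eta>"
    "2 * \<eta> = 1 - a1\<^sup>2 / a\<^sup>2"
    "1 \<le> d * A * cos a * cos b" "1 + d * A * cos a1 \<le> A * sin a1 * cos b"
    "(1 + d * A) * b \<le> A * cos a * cos b * a\<^sup>2 * sqrt \<eta>"
proof -
  have "1 < A * d"
    using Ad d by (smt (verit) real_sqrt_ge_1_iff zero_le_power2)
  then have "A > 0" using d by (smt (verit) mult_nonpos_nonneg)
  \<comment> \<open>the abscissa at which horizontal fronts on the axis begin to burn\<close>
  define as where "as = arccos (1 / (A * d))"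
  have inv: "0 < 1 / (A * d)" "1 / (A * d) < 1" using \<open>1 < A * d\<close> by auto
  have cos_as: "cos as = 1 / (A * d)" unfolding as_def using inv by (intro cos_arccos) linarith+
  have "arccos 1 < as" "as < arccos 0"
    unfolding as_def using inv by (intro arccos_less_arccos; linarith)+
  then have as: "0 < as" "as < pi/2" by auto
  have "1 + 4 * d\<^sup>2 < (A * d)\<^sup>2"
    using Ad \<open>1 < A * d\<close> by (smt (verit) real_sqrt_less_iff real_sqrt_abs)
  then have "4 < ((A * d)\<^sup>2 - 1) / d\<^sup>2"
    using d by (simp add: pos_less_divide_eq)
  also have "\<dots> = A\<^sup>2 * (1 - (1 / (A * d))\<^sup>2)"
    using d \<open>A > 0\<close> by (simp add: field_simps)
  also have "\<dots> = (A * sin as)\<^sup>2"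
    using sin_squared_eq[of as] by (simp add: cos_as power_mult_distrib)
  finally have "2 < A * sin as"
    using as \<open>A > 0\<close> sin_gt_zero[of as] by (intro power2_less_imp_less[of 2]) auto
  then have tip: "1 + d * A * cos as < A * sin as"
    using cos_as \<open>1 < A * d\<close> by (simp add: mult.commute)
  have "((\<lambda>s. A * sin s - d * A * cos s) \<longlongrightarrow> A * sin as - d * A * cos as) (at_left as)"
    by (intro tendsto_intros)
  then have "\<forall>\<^sub>F s in at_left as. 1 < A * sin s - d * A * cos s"
    by (rule order_tendstoD(1)) (use tip in simp)
  moreover have "\<forall>\<^sub>F s in at_left as. s \<in> {0<..<as}"
    using as(1) by (rule eventually_at_left_real)
  ultimately have "\<forall>\<^sub>F s in at_left as. 1 < A * sin s - d * A * cos s \<and> s \<in> {0<..<as}"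
    by (rule eventually_conj)
  then obtain a1 where a1: "1 < A * sin a1 - d * A * cos a1" "0 < a1" "a1 < as"
    using eventually_happens[of _ "at_left as"] by (auto simp: trivial_limit_at_left_real)
  define a where "a = (a1 + as) / 2"
  have a: "a1 < a" "a < as" "0 < a" "a < pi / 2" using a1 as by (auto simp: a_def)
  have "cos as < cos a" using a as by (intro cos_monotone_0_pi) auto
  then have cos_a: "1 < d * A * cos a"
    using \<open>1 < A * d\<close> d \<open>A > 0\<close> by (simp add: cos_as field_simps)
  define \<eta> where "\<eta> = (1 - a1\<^sup>2 / a\<^sup>2) / 2"
  have "a1\<^sup>2 < a\<^sup>2" using a a1 by (intro power_strict_mono) auto
  then have \<eta>: "0 < \<eta>" using a by (auto simp: \<eta>_def field_simps)
  have "0 < cos a" using a by (intro cos_gt_zero_pi) auto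
  \<comment> \<open>all conditions on \<open>b\<close> hold strictly in the limit \<open>b = 0\<close>\<close>
  have "((\<lambda>b. d * A * cos a * cos b) \<longlongrightarrow> d * A * cos a * cos 0) (at_right 0)"
    "((\<lambda>b. A * sin a1 * cos b) \<longlongrightarrow> A * sin a1 * cos 0) (at_right 0)"
    "((\<lambda>b. A * cos a * cos b * a\<^sup>2 * sqrt \<eta> - (1 + d * A) * b) \<longlongrightarrow>
       A * cos a * cos 0 * a\<^sup>2 * sqrt \<eta> - (1 + d * A) * 0) (at_right 0)"
    by (intro tendsto_intros)+
  moreover have "1 < d * A * cos a * cos 0" "1 + d * A * cos a1 < A * sin a1 * cos 0"
    "0 < A * cos a * cos 0 * a\<^sup>2 * sqrt \<eta> - (1 + d * A) * 0"
    using cos_a a1 a \<eta> \<open>0 < cos a\<close> \<open>A > 0\<close> by auto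
  ultimately have "\<forall>\<^sub>F b in at_right 0. 1 < d * A * cos a * cos b \<and> 1 + d * A * cos a1 < A * sin a1 * cos b
      \<and> 0 < A * cos a * cos b * a\<^sup>2 * sqrt \<eta> - (1 + d * A) * b \<and> b \<in> {0<..<1}"
    by (intro eventually_conj order_tendstoD(1) eventually_at_right_real) auto
  then obtain b where b: "1 < d * A * cos a * cos b" "1 + d * A * cos a1 < A * sin a1 * cos b"
      "0 < A * cos a * cos b * a\<^sup>2 * sqrt \<eta> - (1 + d * A) * b" "b \<in> {0<..<1}"
    using eventually_happens[of _ "at_right (0::real)"] by (auto simp: trivial_limit_at_right_real)
  show thesis
    by (rule that[of a1 a b \<eta>]) (use a1 a b \<eta> in \<open>auto simp: \<eta>_def\<close>)
qed

lemma abs_sin_ge: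
  assumes "\<bar>y\<bar> \<le> a" "a < pi/2"
  shows "\<bar>y\<bar> * cos a \<le> \<bar>sin y\<bar>"
proof -
  have *: "y * cos a \<le> sin y" if "0 \<le> y" "y \<le> a" for y
  proof -
    have "sin 0 - 0 * cos a \<le> sin y - y * cos a"
    proof (rule DERIV_nonneg_imp_nondecreasing[OF \<open>0 \<le> y\<close>])
      fix x assume "0 \<le> x" "x \<le> y"
      then have "cos a \<le> cos x" using that assms by (intro cos_monotone_0_pi_le) auto
      then show "\<exists>D. ((\<lambda>y. sin y - y * cos a) has_real_derivative D) (at x) \<and> 0 \<le> D"
        by (intro exI[of _ "cos x - cos a"]) (auto intro!: derivative_eq_intros)
    qed
    then show ?thesis by simp
  qed
  show ?thesis
    using *[of y] *[of "-y"] assms by (cases "y \<ge> 0") (auto simp: abs_if)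
qed

text \<open>
  The burning term for a strain coefficient \<open>m \<ge> 1\<close>: it is quadratically small for nearly vertical \<open>q\<close>.
\<close>

lemma flame_le:
  fixes N q1 q2 m :: real
  assumes "N > 0" "N\<^sup>2 = q1\<^sup>2 + q2\<^sup>2" "1 \<le> m"
  shows "max (1 + m * (q1\<^sup>2 - q2\<^sup>2) / N\<^sup>2) 0 * N \<le> (1 + m) * \<bar>q1\<bar> * (\<bar>q1\<bar> / N)"
proof -
  have "1 + m * (q1\<^sup>2 - q2\<^sup>2) / N\<^sup>2 = ((1 + m) * q1\<^sup>2 - (m - 1) * q2\<^sup>2) / N\<^sup>2"
  proof -
    have "1 + m * (q1\<^sup>2 - q2\<^sup>2) / N\<^sup>2 = (N\<^sup>2 + m * (q1\<^sup>2 - q2\<^sup>2)) / N\<^sup>2"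
      using assms(1) by (simp add: add_divide_distrib)
    also have "N\<^sup>2 + m * (q1\<^sup>2 - q2\<^sup>2) = (1 + m) * q1\<^sup>2 - (m - 1) * q2\<^sup>2"
      by (simp add: assms(2) algebra_simps)
    finally show ?thesis .
  qed
  also have "\<dots> \<le> (1 + m) * q1\<^sup>2 / N\<^sup>2"
    using assms by (intro divide_right_mono) auto
  finally have "max (1 + m * (q1\<^sup>2 - q2\<^sup>2) / N\<^sup>2) 0 \<le> (1 + m) * q1\<^sup>2 / N\<^sup>2"
    using assms by auto
  then have "max (1 + m * (q1\<^sup>2 - q2\<^sup>2) / N\<^sup>2) 0 * N \<le> (1 + m) * q1\<^sup>2 / N\<^sup>2 * N"
    using assms by (intro mult_right_mono) auto
  also have "\<dots> = (1 + m) * \<bar>q1\<bar> * (\<bar>q1\<bar> / N)"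
    using assms(1) by (simp add: power2_eq_square field_simps)
  finally show ?thesis .
qed

lemma abs_less_of_square_less:
  fixes x b :: real
  assumes "x\<^sup>2 < b\<^sup>2" "0 < b"
  shows "\<bar>x\<bar> < b"
proof (rule power2_less_imp_less)
  show "\<bar>x\<bar>\<^sup>2 < b\<^sup>2" using assms(1) by (simp only: power2_abs)
qed (use assms(2) in linarith)

text \<open>
  With \<open>\<Psi> = 1 - y\<^sub>1\<^sup>2 / a\<^sup>2 - y\<^sub>2\<^sup>2 E\<close> and \<open>E = e\<^bsup>2At\<^esup> / b\<^sup>2\<close>, the inequality says \<open>\<Psi>\<^sub>t + H (x, D\<Psi>) \<le> 0\<close> in the
  layer \<open>0 < \<Psi> < \<eta>\<close>. The vertical drift is compensated by \<open>\<Psi>\<^sub>t\<close>, so the horizontal drift has to beat the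
  burning term. Near the tips it does so directly; elsewhere in the layer \<open>|y\<^sub>2| sqrt E \<ge> sqrt \<eta>\<close>, so \<open>D\<Psi>\<close> is
  nearly vertical because \<open>b\<close> is small.
\<close>

lemma barrier_inequality:
  fixes d A a1 a b \<eta> E :: real and x :: "real^2"
  defines "y1 \<equiv> x$1 - pi" and "y2 \<equiv> x$2"
  defines "q \<equiv> vector [- 2 * y1 / a\<^sup>2, - 2 * y2 * E] :: real^2"
  assumes dA: "0 < d" "0 < A"
    and par: "0 < a1" "a1 < a" "a < pi/2" "0 < b" "b \<le> 1" "0 < \<eta>"
    "2 * \<eta> = 1 - a1\<^sup>2 / a\<^sup>2"
    "1 \<le> d * A * cos a * cos b" "1 + d * A * cos a1 \<le> A * sin a1 * cos b"
    "(1 + d * A) * b \<le> A * cos a * cos b * a\<^sup>2 * sqrt \<eta>"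
    and E: "1 / b\<^sup>2 \<le> E"
    and \<Psi>: "0 < 1 - y1\<^sup>2 / a\<^sup>2 - y2\<^sup>2 * E" "1 - y1\<^sup>2 / a\<^sup>2 - y2\<^sup>2 * E < \<eta>"
  shows "- 2 * A * y2\<^sup>2 * E + cell_hamiltonian d A x q \<le> 0"
proof (cases "q = 0")
  case True
  have "0 \<le> 1 / b\<^sup>2" by simp
  then have "0 \<le> E" using E by linarith
  then show ?thesis using True dA by (simp add: cell_hamiltonian_def)
next
  case False
  note pos = par(1-6)
  have "0 < a" using par by linarith
  have "0 < 1 / b\<^sup>2" using pos by simp
  then have "0 < E" using E by linarith
  have "y2\<^sup>2 * (1 / b\<^sup>2) \<le> y2\<^sup>2 * E" using E by (intro mult_left_mono) auto
  moreover have nn: "0 \<le> y1\<^sup>2 / a\<^sup>2" "0 \<le> y2\<^sup>2 * E" using \<open>0 < E\<close> by simp_all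
  ultimately have "y2\<^sup>2 * (1 / b\<^sup>2) < 1" using \<Psi>(1) by linarith
  then have "y2\<^sup>2 < b\<^sup>2" using \<open>0 < b\<close> by (simp add: pos_divide_less_eq)
  from this \<open>0 < b\<close> have y2: "\<bar>y2\<bar> < b" by (rule abs_less_of_square_less)
  have "y1\<^sup>2 / a\<^sup>2 < 1" using \<Psi>(1) nn by linarith
  then have "y1\<^sup>2 < a\<^sup>2" using \<open>0 < a\<close> by (simp add: pos_divide_less_eq)
  from this \<open>0 < a\<close> have y1: "\<bar>y1\<bar> < a" by (rule abs_less_of_square_less)
  have "0 < cos a" using pos \<open>0 < a\<close> by (intro cos_gt_zero_pi) auto
  have "0 < cos b" using pos pi_gt3 by (intro cos_gt_zero_pi) auto
  have cos1: "cos a \<le> cos y1" and cos2: "cos b \<le> cos y2"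
    using y1 y2 pos pi_gt3 cos_monotone_0_pi_le[of "\<bar>y1\<bar>" a] cos_monotone_0_pi_le[of "\<bar>y2\<bar>" b]
    by auto
  define m where "m = d * A * cos y1 * cos y2"
  have "d * A * cos a * cos b \<le> m"
    unfolding m_def using dA cos1 cos2 \<open>0 < cos a\<close> \<open>0 < cos b\<close>
    by (intro mult_mono mult_left_mono) auto
  then have m: "1 \<le> m" using par by linarith
  have m_le: "m \<le> d * A * cos y1"
    unfolding m_def using dA cos1 \<open>0 < cos a\<close> by (intro mult_left_le) auto
  define N where "N = norm q"
  have N: "0 < N" "N\<^sup>2 = (q$1)\<^sup>2 + (q$2)\<^sup>2"
    using False by (auto simp: N_def norm_vec2_sq)
  have q1: "q$1 = - 2 * y1 / a\<^sup>2" and q2: "q$2 = - 2 * y2 * E" by (auto simp: q_def)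
  have key: "(1 + m) * (\<bar>q$1\<bar> / N) \<le> A * \<bar>sin y1\<bar> * cos y2"
  proof (cases "a1 \<le> \<bar>y1\<bar>")
    case True
    have "\<bar>q$1\<bar> \<le> N" unfolding N_def by (rule component_le_norm_cart)
    then have "(1 + m) * (\<bar>q$1\<bar> / N) \<le> (1 + m) * 1"
      using m N by (intro mult_left_mono) auto
    also have "\<dots> \<le> 1 + d * A * cos \<bar>y1\<bar>" using m_le by simp
    also have "\<dots> \<le> 1 + d * A * cos a1"
      using True y1 pos dA by (intro add_left_mono mult_left_mono cos_monotone_0_pi_le) auto
    also have "\<dots> \<le> A * sin a1 * cos b" by (rule par)
    also have "\<dots> \<le> A * sin \<bar>y1\<bar> * cos y2"
    proof -
      have "sin a1 \<le> sin \<bar>y1\<bar>" using True y1 pos by (intro sin_monotone_2pi_le) auto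
      moreover have "0 \<le> sin a1" using pos by (intro sin_ge_zero) auto
      ultimately show ?thesis
        using cos2 dA \<open>0 < cos b\<close> by (intro mult_mono mult_left_mono) auto
    qed
    also have "sin \<bar>y1\<bar> = \<bar>sin y1\<bar>"
      using y1 pos sin_ge_zero[of y1] sin_ge_zero[of "- y1"] by (auto simp: abs_if)
    finally show ?thesis .
  next
    case False
    have "y1\<^sup>2 / a\<^sup>2 \<le> a1\<^sup>2 / a\<^sup>2"
      using False by (intro divide_right_mono) (auto simp: abs_le_square_iff[symmetric])
    then have "\<eta> \<le> y2\<^sup>2 * E" using \<Psi>(2) par(7) by linarith
    then have "\<eta> * (1 / b\<^sup>2) \<le> (y2\<^sup>2 * E) * E"
      using E pos by (intro mult_mono) auto
    also have "\<dots> = (y2 * E)\<^sup>2" by (simp add: power2_eq_square)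
    finally have "sqrt (\<eta> * (1 / b\<^sup>2)) \<le> \<bar>y2 * E\<bar>"
      by (metis real_sqrt_abs real_sqrt_le_iff)
    then have "sqrt \<eta> / b \<le> \<bar>y2 * E\<bar>"
      using pos by (simp add: real_sqrt_mult real_sqrt_divide)
    moreover have "\<bar>q$2\<bar> \<le> N" unfolding N_def by (rule component_le_norm_cart)
    ultimately have "2 * sqrt \<eta> / b \<le> N" by (simp add: q2 abs_mult)
    then have "\<bar>q$1\<bar> / N \<le> \<bar>q$1\<bar> / (2 * sqrt \<eta> / b)"
      using pos N(1) by (intro divide_left_mono) auto
    also have "\<dots> = \<bar>y1\<bar> * (b / (a\<^sup>2 * sqrt \<eta>))"
      using pos by (simp add: q1 abs_mult field_simps)
    finally have "(1 + m) * (\<bar>q$1\<bar> / N) \<le> (1 + d * A) * (\<bar>y1\<bar> * (b / (a\<^sup>2 * sqrt \<eta>)))"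
    proof (rule mult_mono[rotated])
      have "m \<le> d * A" using m_le dA by (smt (verit) cos_le_one mult_left_le mult_pos_pos)
      then show "1 + m \<le> 1 + d * A" by simp
    qed (use m N dA in auto)
    also have "\<dots> = \<bar>y1\<bar> * (((1 + d * A) * b) / (a\<^sup>2 * sqrt \<eta>))" by simp
    also have "\<dots> \<le> \<bar>y1\<bar> * (A * cos a * cos b)"
      using par(10) pos \<open>0 < a\<close> by (intro mult_left_mono) (auto simp: pos_divide_le_eq mult.assoc)
    also have "\<dots> = A * (\<bar>y1\<bar> * cos a) * cos b" by simp
    also have "\<dots> \<le> A * \<bar>sin y1\<bar> * cos y2"
      using dA cos2 \<open>0 < cos b\<close> y1 pos \<open>0 < cos a\<close>
      by (intro mult_mono mult_left_mono abs_sin_ge) auto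
    finally show ?thesis .
  qed
  have cosx: "cos (x$1) = - cos y1" and sinx: "sin (x$1) = - sin y1"
    by (simp_all add: y1_def)
  have flame: "max (1 + m * ((q$1)\<^sup>2 - (q$2)\<^sup>2) / N\<^sup>2) 0 * N \<le> A * \<bar>sin y1\<bar> * cos y2 * \<bar>q$1\<bar>"
    using flame_le[OF N m] mult_right_mono[OF key, of "\<bar>q$1\<bar>"] by (simp add: mult.commute mult.left_commute)
  have ham: "cell_hamiltonian d A x q
      = max (1 + m * ((q$1)\<^sup>2 - (q$2)\<^sup>2) / N\<^sup>2) 0 * N
        + A * sin y1 * cos y2 * q$1 - A * cos y1 * sin y2 * q$2"
    using False by (simp add: cell_hamiltonian_def N_def m_def inner_vec2 cosx sinx y2_def[symmetric]
        right_diff_distrib minus_divide_left algebra_simps)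
  have drift1: "A * sin y1 * cos y2 * q$1 = - (A * \<bar>sin y1\<bar> * cos y2 * \<bar>q$1\<bar>)"
  proof -
    have "sin y1 * y1 = \<bar>sin y1\<bar> * \<bar>y1\<bar>"
      using y1 pos sin_ge_zero[of y1] sin_ge_zero[of "- y1"] by (cases "0 \<le> y1") auto
    then show ?thesis by (simp add: q1 abs_mult)
  qed
  have drift2: "- (A * cos y1 * sin y2 * q$2) \<le> 2 * A * y2\<^sup>2 * E"
  proof -
    have "cos y1 * (sin y2 * y2) \<le> \<bar>cos y1\<bar> * (\<bar>sin y2\<bar> * \<bar>y2\<bar>)"
      by (metis abs_ge_self abs_mult)
    also have "\<dots> \<le> 1 * (\<bar>y2\<bar> * \<bar>y2\<bar>)"
      by (intro mult_mono abs_sin_x_le_abs_x) auto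
    finally have "(cos y1 * (sin y2 * y2)) * (2 * A * E) \<le> y2\<^sup>2 * (2 * A * E)"
      using dA \<open>0 < E\<close> by (intro mult_right_mono) (auto simp: power2_eq_square)
    then show ?thesis by (simp add: q2 mult.commute mult.left_commute)
  qed
  show ?thesis unfolding ham using flame drift1 drift2 by linarith
qed

lemma DERIV_pos_part_square:
  "((\<lambda>x::real. (max 0 x)\<^sup>2) has_real_derivative 2 * max 0 x) (at x)"
proof -
  consider "x < 0" | "x > 0" | "x = 0" by linarith
  then show ?thesis
  proof cases
    case 1
    have "((\<lambda>x::real. 0) has_real_derivative 2 * max 0 x) (at x)" using 1 by simp
    then show ?thesis
      by (rule has_field_derivative_transform_within_open[where S = "{..<0}"]) (use 1 in auto)
  next
    case 2
    have "((\<lambda>x::real. x\<^sup>2) has_real_derivative 2 * max 0 x) (at x)"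
      using 2 by (auto intro!: derivative_eq_intros)
    then show ?thesis
      by (rule has_field_derivative_transform_within_open[where S = "{0<..}"]) (use 2 in auto)
  next
    case 3
    have "((\<lambda>h::real. (max 0 h)\<^sup>2 / h) \<longlongrightarrow> 0) (at 0)"
    proof (rule Lim_null_comparison)
      show "\<forall>\<^sub>F h in at 0. norm ((max 0 h)\<^sup>2 / h) \<le> \<bar>h\<bar>"
        by (rule always_eventually) (auto simp: max_def power2_eq_square)
      show "((\<lambda>h::real. \<bar>h\<bar>) \<longlongrightarrow> 0) (at 0)"
        by (rule tendsto_rabs_zero) (rule tendsto_ident_at)
    qed
    then show ?thesis using 3 by (simp add: DERIV_def)
  qed
qed

lemma continuous_on_vector2 [continuous_intros]:
  fixes S :: "'a::t2_space set"
  assumes "continuous_on S f" "continuous_on S g"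
  shows "continuous_on S (\<lambda>x. vector [f x, g x] :: real^2)"
proof (subst continuous_on_componentwise, intro ballI)
  fix i :: "real^2" assume "i \<in> Basis"
  then obtain k where "i = axis k 1" by (auto simp: Basis_vec_def)
  then show "continuous_on S (\<lambda>x. vector [f x, g x] \<bullet> i)"
    using exhaust_2[of k] assms by (auto simp: inner_axis)
qed

text \<open>
  The defining function of the shrinking lens around \<open>x_s = (\<pi>, 0)\<close>, positive inside; the argument is
  \<open>z = (x, t)\<close>.
\<close>

definition barrier_level :: "real \<Rightarrow> real \<Rightarrow> real \<Rightarrow> (real^2) \<times> real \<Rightarrow> real" where
  "barrier_level A a b z = 1 - (fst z $ 1 - pi)\<^sup>2 / a\<^sup>2 - (fst z $ 2)\<^sup>2 * (exp (2 * A * snd z) / b\<^sup>2)"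

lemma barrier_level_has_derivative:
  "(barrier_level A a b has_derivative (\<lambda>(h, s).
      vector [- 2 * (fst z $ 1 - pi) / a\<^sup>2, - 2 * (fst z $ 2) * (exp (2 * A * snd z) / b\<^sup>2)] \<bullet> h
      + (- 2 * A * (fst z $ 2)\<^sup>2 * (exp (2 * A * snd z) / b\<^sup>2)) * s)) (at z)"
proof -
  have [derivative_intros]: "((\<lambda>z. fst z $ j) has_derivative (\<lambda>h. fst h $ j)) (at z)"
    for z :: "(real^2) \<times> real" and j
    by (rule bounded_linear_imp_has_derivative)
       (intro bounded_linear_intros bounded_linear_compose[OF bounded_linear_vec_nth])
  have "((\<lambda>z. 1 - (fst z $ 1 - pi)\<^sup>2 * \<alpha> - (fst z $ 2)\<^sup>2 * (exp (2 * A * snd z) * \<beta>)) has_derivative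
    (\<lambda>(h, s). vector [- 2 * (fst z $ 1 - pi) * \<alpha>, - 2 * (fst z $ 2) * (exp (2 * A * snd z) * \<beta>)] \<bullet> h
      + (- 2 * A * (fst z $ 2)\<^sup>2 * (exp (2 * A * snd z) * \<beta>)) * s)) (at z)" for \<alpha> \<beta>
    by (auto intro!: derivative_eq_intros simp: fun_eq_iff inner_vec2 algebra_simps power2_eq_square)
  from this[of "inverse (a\<^sup>2)" "inverse (b\<^sup>2)"] show ?thesis
    unfolding barrier_level_def divide_inverse .
qed

lemma barrier_C1_test:
  fixes A a b \<eta> m M \<sigma> Q T :: real
  defines "w \<equiv> \<lambda>z. 2 * M * max 0 (\<eta> - barrier_level A a b z)"
  assumes ab: "a \<noteq> 0" "b \<noteq> 0"
  shows "C1_test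
    (\<lambda>z. - m - M * (max 0 (\<eta> - barrier_level A a b z))\<^sup>2 - \<sigma> * snd z - Q * (max 0 (snd z - T))\<^sup>2)
    (\<lambda>z. w z *\<^sub>R vector [- 2 * (fst z $ 1 - pi) / a\<^sup>2, - 2 * (fst z $ 2) * (exp (2 * A * snd z) / b\<^sup>2)])
    (\<lambda>z. w z * (- 2 * A * (fst z $ 2)\<^sup>2 * (exp (2 * A * snd z) / b\<^sup>2)) - \<sigma> - 2 * Q * max 0 (snd z - T))"
  unfolding C1_test_def
proof (intro conjI ballI)
  fix z :: "(real^2) \<times> real"
  have 1: "((\<lambda>z. (max 0 (\<eta> - barrier_level A a b z))\<^sup>2) has_derivative (\<lambda>h. 2 * max 0 (\<eta> - barrier_level A a b z) *
      - (case h of (h, s) \<Rightarrow> vector [- 2 * (fst z $ 1 - pi) / a\<^sup>2, - 2 * (fst z $ 2) * (exp (2 * A * snd z) / b\<^sup>2)] \<bullet> h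
      + (- 2 * A * (fst z $ 2)\<^sup>2 * (exp (2 * A * snd z) / b\<^sup>2)) * s))) (at z)"
    by (rule has_derivative_compose[OF _ DERIV_pos_part_square[unfolded has_field_derivative_def]])
       (auto intro!: derivative_eq_intros barrier_level_has_derivative simp: fun_eq_iff)
  have 2: "((\<lambda>z::(real^2) \<times> real. (max 0 (snd z - T))\<^sup>2) has_derivative (\<lambda>h. 2 * max 0 (snd z - T) * snd h)) (at z)"
    by (rule has_derivative_compose[OF _ DERIV_pos_part_square[unfolded has_field_derivative_def]])
       (auto intro!: derivative_eq_intros)
  show "((\<lambda>z. - m - M * (max 0 (\<eta> - barrier_level A a b z))\<^sup>2 - \<sigma> * snd z - Q * (max 0 (snd z - T))\<^sup>2)
    has_derivative (\<lambda>(h, s). (w z *\<^sub>R vector [- 2 * (fst z $ 1 - pi) / a\<^sup>2, - 2 * (fst z $ 2) * (exp (2 * A * snd z) / b\<^sup>2)]) \<bullet> h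
    + (w z * (- 2 * A * (fst z $ 2)\<^sup>2 * (exp (2 * A * snd z) / b\<^sup>2)) - \<sigma> - 2 * Q * max 0 (snd z - T)) * s)) (at z)"
    by (rule derivative_eq_intros 1 2 refl)+ (auto simp: fun_eq_iff w_def algebra_simps)
qed (use ab in \<open>auto simp: w_def barrier_level_def intro!: continuous_intros\<close>)

text \<open>
  The comparison function equals \<open>- 2\<pi> - \<sigma> t\<close> in the core \<open>\<Psi> \<ge> \<eta>\<close> of the lens up to time \<open>T\<close>. It falls below
  \<open>g\<close> towards the boundary of the lens and by time \<open>T + 1\<close>, so that the minimum of the difference, if
  negative, is attained at an interior point.
\<close>

lemma supersolution_lower_bound:
  assumes d: "0 < d" and Ad: "sqrt (1 + 4 * d\<^sup>2) < A * d"
    and cont: "continuous_on spacetime g"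
    and super: "viscosity_supersolution (cell_hamiltonian d A) g"
    and init: "\<And>x. g (x, 0) = p \<bullet> x" and p: "norm p = 1" and T: "T \<ge> 0"
  shows "- (2 * pi) - 1 \<le> g (x_s, T)"
proof (rule ccontr)
  assume neg: "\<not> ?thesis"
  have "1 < A * d"
    using Ad d by (smt (verit) real_sqrt_ge_1_iff zero_le_power2)
  then have A: "A > 0" using d by (smt (verit) mult_nonpos_nonneg)
  obtain a1 a b \<eta> where par: "0 < a1" "a1 < a" "a < pi/2" "0 < b" "b \<le> 1" "0 < \<eta>"
    "2 * \<eta> = 1 - a1\<^sup>2 / a\<^sup>2"
    "1 \<le> d * A * cos a * cos b" "1 + d * A * cos a1 \<le> A * sin a1 * cos b"
    "(1 + d * A) * b \<le> A * cos a * cos b * a\<^sup>2 * sqrt \<eta>"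
    by (rule barrier_parameters[OF d Ad])
  have "0 < a" using par by linarith
  have "0 \<le> a1\<^sup>2 / a\<^sup>2" by simp
  then have "\<eta> < 1" using par(7) by linarith
  define R :: "(real^2) set" where "R = cbox (vector [0, - 2]) (vector [2 * pi, 2])"
  define K where "K = R \<times> {0..T + 1}"
  have K: "compact K" "K \<subseteq> spacetime"
    by (auto simp: K_def R_def spacetime_def intro: compact_Times)
  have gK: "continuous_on K g" using cont K(2) by (rule continuous_on_subset)
  obtain B where B: "\<And>z. z \<in> K \<Longrightarrow> \<bar>g z\<bar> \<le> B"
    using compact_imp_bounded[OF compact_continuous_image[OF gK K(1)]]
    unfolding bounded_iff by (metis imageI real_norm_def)
  define M where "M = (\<bar>B\<bar> + 1) / \<eta>\<^sup>2"
  define \<sigma> where "\<sigma> = 1 / (T + 1)"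
  define Q where "Q = \<bar>B\<bar> + 1"
  have pos: "0 < M" "0 < \<sigma>" "0 < Q" "\<sigma> * T \<le> 1"
    using T par(6) by (auto simp: M_def \<sigma>_def Q_def add_nonneg_pos)
  let ?\<Psi> = "barrier_level A a b"
  define \<phi> where "\<phi> = (\<lambda>z. - (2 * pi) - M * (max 0 (\<eta> - ?\<Psi> z))\<^sup>2 - \<sigma> * snd z - Q * (max 0 (snd z - T))\<^sup>2)"
  let ?w = "\<lambda>z. 2 * M * max 0 (\<eta> - ?\<Psi> z)"
  let ?E = "\<lambda>z. exp (2 * A * snd z) / b\<^sup>2"
  let ?q = "\<lambda>z. vector [- 2 * (fst z $ 1 - pi) / a\<^sup>2, - 2 * (fst z $ 2) * ?E z] :: real^2"
  have \<phi>: "C1_test \<phi> (\<lambda>z. ?w z *\<^sub>R ?q z)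
      (\<lambda>z. ?w z * (- 2 * A * (fst z $ 2)\<^sup>2 * ?E z) - \<sigma> - 2 * Q * max 0 (snd z - T))"
    unfolding \<phi>_def using par(4) \<open>0 < a\<close> by (intro barrier_C1_test) auto
  have "continuous_on K (\<lambda>z. g z - \<phi> z)"
    unfolding \<phi>_def barrier_level_def using gK par(4) \<open>0 < a\<close> by (auto intro!: continuous_intros)
  moreover have xsK: "(x_s, T) \<in> K"
    using T pi_gt_zero by (auto simp: K_def R_def mem_box_cart forall_2 x_s_def)
  ultimately obtain z where z: "z \<in> K" "\<And>w. w \<in> K \<Longrightarrow> g z - \<phi> z \<le> g w - \<phi> w"
    using continuous_attains_inf[OF K(1)] by blast
  have "g z - \<phi> z \<le> g (x_s, T) - \<phi> (x_s, T)" by (rule z(2)[OF xsK])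
  also have "\<dots> < 0"
    using neg pos(4) par(6) \<open>\<eta> < 1\<close>
    by (simp add: \<phi>_def barrier_level_def x_s_def max_def)
  finally have gz: "g z < \<phi> z" by simp
  have nn: "0 \<le> M * (max 0 (\<eta> - ?\<Psi> z))\<^sup>2" "0 \<le> \<sigma> * snd z" "0 \<le> Q * (max 0 (snd z - T))\<^sup>2"
    using pos z(1) by (auto simp: K_def intro!: mult_nonneg_nonneg)
  have gB: "- \<bar>B\<bar> \<le> g z" using B[OF z(1)] by linarith
  \<comment> \<open>by the choice of \<open>M\<close> and \<open>Q\<close> the minimum lies inside the shrinking ellipse and before time \<open>T + 1\<close>\<close>
  have \<Psi>: "0 < ?\<Psi> z"
  proof (rule ccontr)
    assume "\<not> 0 < ?\<Psi> z"
    then have "\<eta>\<^sup>2 \<le> (max 0 (\<eta> - ?\<Psi> z))\<^sup>2"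
      using par(6) by (intro power_mono) auto
    then have "M * \<eta>\<^sup>2 \<le> M * (max 0 (\<eta> - ?\<Psi> z))\<^sup>2"
      using pos by (intro mult_left_mono) auto
    then have "\<bar>B\<bar> + 1 \<le> M * (max 0 (\<eta> - ?\<Psi> z))\<^sup>2" using par(6) by (simp add: M_def)
    then show False using gz nn gB pi_gt_zero by (simp add: \<phi>_def)
  qed
  have late: "snd z < T + 1"
  proof (rule ccontr)
    assume "\<not> snd z < T + 1"
    then have "1\<^sup>2 \<le> (max 0 (snd z - T))\<^sup>2" by (intro power_mono) auto
    then have "Q * 1\<^sup>2 \<le> Q * (max 0 (snd z - T))\<^sup>2"
      using pos by (intro mult_left_mono) auto
    then have "\<bar>B\<bar> + 1 \<le> Q * (max 0 (snd z - T))\<^sup>2" by (simp add: Q_def)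
    then show False using gz nn gB pi_gt_zero by (simp add: \<phi>_def)
  qed
  have E: "1 / b\<^sup>2 \<le> ?E z"
    using z(1) A by (auto simp: K_def intro!: divide_right_mono)
  have y: "\<bar>fst z $ 1 - pi\<bar> < a" "\<bar>fst z $ 2\<bar> < b"
  proof -
    have "0 < 1 / b\<^sup>2" using par(4) by simp
    then have "0 < ?E z" using E by linarith
    then have nn: "0 \<le> (fst z $ 1 - pi)\<^sup>2 / a\<^sup>2" "0 \<le> (fst z $ 2)\<^sup>2 * ?E z" by simp_all
    have "(fst z $ 2)\<^sup>2 * (1 / b\<^sup>2) \<le> (fst z $ 2)\<^sup>2 * ?E z" using E by (intro mult_left_mono) auto
    then have "(fst z $ 2)\<^sup>2 * (1 / b\<^sup>2) < 1" "(fst z $ 1 - pi)\<^sup>2 / a\<^sup>2 < 1"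
      using \<Psi> nn unfolding barrier_level_def by linarith+
    then have "(fst z $ 2)\<^sup>2 < b\<^sup>2" "(fst z $ 1 - pi)\<^sup>2 < a\<^sup>2"
      using par(4) \<open>0 < a\<close> by (simp_all add: pos_divide_less_eq)
    then show "\<bar>fst z $ 1 - pi\<bar> < a" "\<bar>fst z $ 2\<bar> < b"
      using par(4) \<open>0 < a\<close> abs_less_of_square_less by blast+
  qed
  \<comment> \<open>at time \<open>0\<close> the lens lies in the ball of radius \<open>2\<pi>\<close>, where \<open>g \<ge> - 2\<pi>\<close>\<close>
  have early: "0 < snd z"
  proof (rule ccontr)
    assume "\<not> 0 < snd z"
    then have "z = (fst z, 0)" using z(1) by (auto simp: K_def prod_eq_iff)
    then have "g z = p \<bullet> fst z" using init by metis
    moreover have "- norm (fst z) \<le> p \<bullet> fst z"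
      using Cauchy_Schwarz_ineq2[of p "fst z"] p by simp
    moreover have "norm (fst z) \<le> \<bar>fst z $ 1\<bar> + \<bar>fst z $ 2\<bar>"
      using norm_le_l1_cart[of "fst z"] by (simp add: sum_2)
    ultimately show False
      using gz nn y par pi_gt3 by (simp add: \<phi>_def)
  qed
  have "z \<in> box (vector [0, - 2]) (vector [2 * pi, 2]) \<times> {0<..<T + 1}"
    using y par early late pi_gt_zero by (auto simp: mem_Times_iff mem_box_cart forall_2)
  then have "\<forall>\<^sub>F w in nhds z. w \<in> box (vector [0, - 2]) (vector [2 * pi, 2]) \<times> {0<..<T + 1}"
    by (intro eventually_nhds_in_open open_Times) auto
  then have "\<forall>\<^sub>F w in nhds z. g z - \<phi> z \<le> g w - \<phi> w"
  proof eventually_elim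
    case (elim w)
    then have "w \<in> K" using box_subset_cbox by (fastforce simp: K_def R_def)
    then show ?case by (rule z(2))
  qed
  then have "local_min_at (\<lambda>z. g z - \<phi> z) (fst z, snd z)" by (simp add: local_min_at_def)
  with \<phi> early
  have "C1_test \<phi> (\<lambda>z. ?w z *\<^sub>R ?q z)
      (\<lambda>z. ?w z * (- 2 * A * (fst z $ 2)\<^sup>2 * ?E z) - \<sigma> - 2 * Q * max 0 (snd z - T))
      \<and> 0 < snd z \<and> local_min_at (\<lambda>z. g z - \<phi> z) (fst z, snd z)" by blast
  from conjunct2[OF super[unfolded viscosity_supersolution_def], rule_format, OF this]
  have "0 \<le> ?w z * (- 2 * A * (fst z $ 2)\<^sup>2 * ?E z) - \<sigma> - 2 * Q * max 0 (snd z - T)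
      + cell_hamiltonian d A (fst z) (?w z *\<^sub>R ?q z)" by simp
  also have "cell_hamiltonian d A (fst z) (?w z *\<^sub>R ?q z) = ?w z * cell_hamiltonian d A (fst z) (?q z)"
    using pos by (intro cell_hamiltonian_scaleR) auto
  finally have le: "\<sigma> + 2 * Q * max 0 (snd z - T)
      \<le> ?w z * (- 2 * A * (fst z $ 2)\<^sup>2 * ?E z + cell_hamiltonian d A (fst z) (?q z))"
    unfolding distrib_left by linarith
  have "?w z * (- 2 * A * (fst z $ 2)\<^sup>2 * ?E z + cell_hamiltonian d A (fst z) (?q z)) \<le> 0"
  proof (cases "?\<Psi> z < \<eta>")
    case True
    have "- 2 * A * (fst z $ 2)\<^sup>2 * ?E z + cell_hamiltonian d A (fst z) (?q z) \<le> 0"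
      using \<Psi> True unfolding barrier_level_def by (rule barrier_inequality[OF d A par E])
    then show ?thesis using pos by (intro mult_nonneg_nonpos) auto
  qed auto
  moreover have "0 \<le> 2 * Q * max 0 (snd z - T)" using pos by simp
  ultimately show False using le pos by linarith
qed

section \<open>Controlled arcs in a cell\<close>

text \<open>
  A minorant of the Hamiltonian that is convex in \<open>q\<close>: drift together with burning at the isotropic speed
  \<open>max 0 (1 - d A |cos x\<^sub>1 cos x\<^sub>2|)\<close>.
\<close>

lemma cell_hamiltonian_ge:
  assumes "0 \<le> d" "0 \<le> A"
  shows "VA A x \<bullet> q + max 0 (1 - d * A * \<bar>cos (x$1) * cos (x$2)\<bar>) * norm q \<le> cell_hamiltonian d A x q"
proof (cases "q = 0")
  case False
  then have N: "(norm q)\<^sup>2 > 0" by simp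
  let ?c = "cos (x$1) * cos (x$2)"
  have "\<bar>?c * ((q$2)\<^sup>2 - (q$1)\<^sup>2)\<bar> \<le> \<bar>?c\<bar> * (norm q)\<^sup>2"
    unfolding abs_mult norm_vec2_sq by (intro mult_left_mono) (auto simp: abs_if)
  then have "- (\<bar>?c\<bar> * (norm q)\<^sup>2) \<le> ?c * ((q$2)\<^sup>2 - (q$1)\<^sup>2)" by linarith
  then have "d * A * - (\<bar>?c\<bar> * (norm q)\<^sup>2) \<le> d * A * (?c * ((q$2)\<^sup>2 - (q$1)\<^sup>2))"
    using assms by (intro mult_left_mono) auto
  then have "(- (d * A * \<bar>?c\<bar>)) * (norm q)\<^sup>2 \<le> d * A * cos (x$1) * cos (x$2) * ((q$2)\<^sup>2 - (q$1)\<^sup>2)"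
    by (simp add: mult.assoc)
  then have "- (d * A * \<bar>?c\<bar>) \<le> d * A * cos (x$1) * cos (x$2) * ((q$2)\<^sup>2 - (q$1)\<^sup>2) / (norm q)\<^sup>2"
    using N by (simp only: pos_le_divide_eq)
  then have "max 0 (1 - d * A * \<bar>?c\<bar>) * norm q
      \<le> max (1 + d * A * cos (x$1) * cos (x$2) * ((q$2)\<^sup>2 - (q$1)\<^sup>2) / (norm q)\<^sup>2) 0 * norm q"
    by (intro mult_right_mono) auto
  with False show ?thesis by (simp add: cell_hamiltonian_def)
qed (simp add: cell_hamiltonian_def)

lemma abs_sin_diff_le: "\<bar>sin x - sin y\<bar> \<le> \<bar>x - y\<bar>" for x y :: real
proof -
  have "\<bar>sin x - sin y\<bar> = 2 * \<bar>sin ((x - y) / 2)\<bar> * \<bar>cos ((x + y) / 2)\<bar>"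
    by (simp add: sin_diff_sin abs_mult)
  also have "\<dots> \<le> 2 * \<bar>(x - y) / 2\<bar> * 1"
    by (intro mult_mono mult_left_mono abs_sin_x_le_abs_x) auto
  finally show ?thesis by simp
qed

lemma abs_cos_diff_le: "\<bar>cos x - cos y\<bar> \<le> \<bar>x - y\<bar>" for x y :: real
  using abs_sin_diff_le[of "pi/2 - x" "pi/2 - y"] by (simp add: sin_diff)

lemma abs_mult_diff_le:
  fixes a b a' b' :: real
  assumes "\<bar>b\<bar> \<le> 1" "\<bar>a'\<bar> \<le> 1"
  shows "\<bar>a * b - a' * b'\<bar> \<le> \<bar>a - a'\<bar> + \<bar>b - b'\<bar>"
proof -
  have "\<bar>a * b - a' * b'\<bar> = \<bar>(a - a') * b + a' * (b - b')\<bar>" by (simp add: algebra_simps)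
  also have "\<dots> \<le> \<bar>a - a'\<bar> * \<bar>b\<bar> + \<bar>a'\<bar> * \<bar>b - b'\<bar>"
    by (metis abs_mult abs_triangle_ineq)
  also have "\<dots> \<le> \<bar>a - a'\<bar> * 1 + 1 * \<bar>b - b'\<bar>"
    using assms by (intro add_mono mult_left_mono mult_right_mono) auto
  finally show ?thesis by simp
qed

lemma VA_lipschitz:
  assumes "0 \<le> d" "0 \<le> A"
  defines "r \<equiv> \<lambda>x::real^2. max 0 (1 - d * A * \<bar>cos (x$1) * cos (x$2)\<bar>)"
  shows "norm (VA A x - VA A y) \<le> (4 * A + 2 * d * A) * norm (x - y)"
    and "\<bar>r x - r y\<bar> \<le> (4 * A + 2 * d * A) * norm (x - y)"
proof -
  have comp: "\<bar>x$1 - y$1\<bar> + \<bar>x$2 - y$2\<bar> \<le> 2 * norm (x - y)"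
    using component_le_norm_cart[of "x - y" 1] component_le_norm_cart[of "x - y" 2] by simp
  have sc: "\<bar>sin (x$1) * cos (x$2) - sin (y$1) * cos (y$2)\<bar> \<le> 2 * norm (x - y)"
    using abs_mult_diff_le[of "cos (x$2)" "sin (y$1)" "sin (x$1)" "cos (y$2)"]
      abs_sin_diff_le[of "x$1" "y$1"] abs_cos_diff_le[of "x$2" "y$2"] comp by simp
  have cs: "\<bar>cos (x$1) * sin (x$2) - cos (y$1) * sin (y$2)\<bar> \<le> 2 * norm (x - y)"
    using abs_mult_diff_le[of "sin (x$2)" "cos (y$1)" "cos (x$1)" "sin (y$2)"]
      abs_cos_diff_le[of "x$1" "y$1"] abs_sin_diff_le[of "x$2" "y$2"] comp by simp
  have cc: "\<bar>cos (x$1) * cos (x$2) - cos (y$1) * cos (y$2)\<bar> \<le> 2 * norm (x - y)"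
    using abs_mult_diff_le[of "cos (x$2)" "cos (y$1)" "cos (x$1)" "cos (y$2)"]
      abs_cos_diff_le[of "x$1" "y$1"] abs_cos_diff_le[of "x$2" "y$2"] comp by simp
  have "norm (VA A x - VA A y) \<le> \<bar>(VA A x - VA A y)$1\<bar> + \<bar>(VA A x - VA A y)$2\<bar>"
    using norm_le_l1_cart[of "VA A x - VA A y"] by (simp add: sum_2)
  also have "\<dots> = A * \<bar>sin (x$1) * cos (x$2) - sin (y$1) * cos (y$2)\<bar>
      + A * \<bar>cos (x$1) * sin (x$2) - cos (y$1) * sin (y$2)\<bar>"
  proof -
    have "(VA A x - VA A y)$1 = - (A * (sin (x$1) * cos (x$2) - sin (y$1) * cos (y$2)))"
      "(VA A x - VA A y)$2 = A * (cos (x$1) * sin (x$2) - cos (y$1) * sin (y$2))"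
      by (simp_all add: right_diff_distrib)
    then show ?thesis using assms by (simp only: abs_mult abs_minus abs_of_nonneg)
  qed
  also have "\<dots> \<le> A * (2 * norm (x - y)) + A * (2 * norm (x - y))"
    using assms sc cs by (intro add_mono mult_left_mono) auto
  also have "\<dots> \<le> (4 * A + 2 * d * A) * norm (x - y)"
    using assms by (simp add: algebra_simps)
  finally show "norm (VA A x - VA A y) \<le> (4 * A + 2 * d * A) * norm (x - y)" .
  have "\<bar>r x - r y\<bar> \<le> \<bar>d * A * \<bar>cos (x$1) * cos (x$2)\<bar> - d * A * \<bar>cos (y$1) * cos (y$2)\<bar>\<bar>"
    unfolding r_def by linarith
  also have "\<dots> = d * A * \<bar>\<bar>cos (x$1) * cos (x$2)\<bar> - \<bar>cos (y$1) * cos (y$2)\<bar>\<bar>"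
    using assms by (simp only: right_diff_distrib[symmetric] abs_mult abs_of_nonneg)
  also have "\<dots> \<le> d * A * \<bar>cos (x$1) * cos (x$2) - cos (y$1) * cos (y$2)\<bar>"
    using assms by (intro mult_left_mono abs_triangle_ineq3) auto
  also have "\<dots> \<le> d * A * (2 * norm (x - y))"
    using assms cc by (intro mult_left_mono) auto
  also have "\<dots> \<le> (4 * A + 2 * d * A) * norm (x - y)"
    using assms by (simp add: algebra_simps)
  finally show "\<bar>r x - r y\<bar> \<le> (4 * A + 2 * d * A) * norm (x - y)" .
qed

text \<open>
  A controlled curve in coordinates \<open>(\<alpha>, \<beta>)\<close> adapted to an edge of a cell: \<open>\<alpha>\<close> is measured from the midpoint
  of the edge in the direction of the flow, \<open>\<beta>\<close> across the edge. The flow is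
  \<open>(A cos \<alpha> cos \<beta>, A sin \<alpha> sin \<beta>)\<close>, with the next corner of the cell at \<open>(\<pi>/2, 0)\<close> and the midpoint of the
  next edge at \<open>(\<pi>/2, \<pi>/2)\<close>. The curve runs from \<open>P\<close> to \<open>Q\<close> and takes the time \<open>T\<close>; its deviation from the
  flow is measured in the \<open>1\<close>-norm.
\<close>

definition drift_arc :: "real \<Rightarrow> real \<Rightarrow> real \<times> real \<Rightarrow> real \<times> real \<Rightarrow> real \<Rightarrow> bool" where
  "drift_arc d A P Q T \<longleftrightarrow> (\<exists>\<alpha> \<alpha>' \<beta> \<beta>' \<theta> \<theta>' a b. a < b \<and> (\<alpha> a, \<beta> a) = P \<and> (\<alpha> b, \<beta> b) = Q \<and> \<theta> b - \<theta> a = T \<and>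
     (\<forall>s\<in>{a..b}. (\<alpha> has_real_derivative \<alpha>' s) (at s within {a..b}) \<and>
        (\<beta> has_real_derivative \<beta>' s) (at s within {a..b}) \<and>
        (\<theta> has_real_derivative \<theta>' s) (at s within {a..b}) \<and> 0 < \<theta>' s \<and>
        \<bar>\<alpha>' s - \<theta>' s * (A * (cos (\<alpha> s) * cos (\<beta> s)))\<bar> + \<bar>\<beta>' s - \<theta>' s * (A * (sin (\<alpha> s) * sin (\<beta> s)))\<bar>
          \<le> \<theta>' s * max 0 (1 - d * A * \<bar>sin (\<alpha> s) * cos (\<beta> s)\<bar>)))"

lemma drift_arcE:
  assumes "drift_arc d A (\<alpha>0, \<beta>0) (\<alpha>1, \<beta>1) T"
  obtains \<alpha> \<alpha>' \<beta> \<beta>' \<theta> \<theta>' :: "real \<Rightarrow> real" and a b where "a < b"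
    "\<alpha> a = \<alpha>0" "\<beta> a = \<beta>0" "\<alpha> b = \<alpha>1" "\<beta> b = \<beta>1" "\<theta> b - \<theta> a = T"
    "\<And>s. s \<in> {a..b} \<Longrightarrow> (\<alpha> has_real_derivative \<alpha>' s) (at s within {a..b}) \<and>
        (\<beta> has_real_derivative \<beta>' s) (at s within {a..b}) \<and>
        (\<theta> has_real_derivative \<theta>' s) (at s within {a..b}) \<and> 0 < \<theta>' s \<and>
        \<bar>\<alpha>' s - \<theta>' s * (A * (cos (\<alpha> s) * cos (\<beta> s)))\<bar> + \<bar>\<beta>' s - \<theta>' s * (A * (sin (\<alpha> s) * sin (\<beta> s)))\<bar>
          \<le> \<theta>' s * max 0 (1 - d * A * \<bar>sin (\<alpha> s) * cos (\<beta> s)\<bar>)"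
  using assms unfolding drift_arc_def prod.inject
  by (elim exE conjE) (rule that; (assumption | erule bspec, assumption))

lemma drift_arc_duration_pos:
  assumes "drift_arc d A P Q T"
  shows "0 < T"
proof -
  obtain \<theta> \<theta>' :: "real \<Rightarrow> real" and a b where *: "a < b" "\<theta> b - \<theta> a = T"
    "\<And>s. s \<in> {a..b} \<Longrightarrow> (\<theta> has_real_derivative \<theta>' s) (at s within {a..b}) \<and> 0 < \<theta>' s"
    using assms unfolding drift_arc_def by blast
  have "\<exists>x\<in>{a..b}. \<theta> b - \<theta> a = (\<lambda>h. \<theta>' x * h) (b - a)"
    using * by (intro mvt_very_simple) (auto simp: has_field_derivative_def)
  then show ?thesis using * by auto
qed

text \<open>
  The reflection in the diagonal through the corner, combined with time reversal, preserves the flow.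
\<close>

lemma drift_arc_mirror:
  assumes "drift_arc d A (\<alpha>0, \<beta>0) (\<alpha>1, \<beta>1) T"
  shows "drift_arc d A (pi/2 - \<beta>1, pi/2 - \<alpha>1) (pi/2 - \<beta>0, pi/2 - \<alpha>0) T"
proof -
  obtain \<alpha> \<alpha>' \<beta> \<beta>' \<theta> \<theta>' :: "real \<Rightarrow> real" and a b where ab: "a < b"
    and ends: "\<alpha> a = \<alpha>0" "\<beta> a = \<beta>0" "\<alpha> b = \<alpha>1" "\<beta> b = \<beta>1" "\<theta> b - \<theta> a = T"
    and arc: "\<And>s. s \<in> {a..b} \<Longrightarrow> (\<alpha> has_real_derivative \<alpha>' s) (at s within {a..b}) \<and>
        (\<beta> has_real_derivative \<beta>' s) (at s within {a..b}) \<and>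
        (\<theta> has_real_derivative \<theta>' s) (at s within {a..b}) \<and> 0 < \<theta>' s \<and>
        \<bar>\<alpha>' s - \<theta>' s * (A * (cos (\<alpha> s) * cos (\<beta> s)))\<bar> + \<bar>\<beta>' s - \<theta>' s * (A * (sin (\<alpha> s) * sin (\<beta> s)))\<bar>
          \<le> \<theta>' s * max 0 (1 - d * A * \<bar>sin (\<alpha> s) * cos (\<beta> s)\<bar>)"
    by (rule drift_arcE[OF assms]) blast
  have rev: "((\<lambda>s. f (- s)) has_real_derivative - f' (- s)) (at s within {- b..- a})"
    if "(f has_real_derivative f' (- s)) (at (- s) within {a..b})" for f f' :: "real \<Rightarrow> real" and s
  proof -
    have "uminus ` {- b..- a} = {a..b}" by simp
    with that have "(f has_real_derivative f' (- s)) (at (- s) within uminus ` {- b..- a})" by simp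
    moreover have "(uminus has_real_derivative -1) (at s within {- b..- a})"
      by (auto intro!: derivative_eq_intros)
    ultimately have "(f \<circ> uminus has_real_derivative f' (- s) * -1) (at s within {- b..- a})"
      by (rule DERIV_image_chain)
    then show ?thesis by (simp add: o_def)
  qed
  show ?thesis
    unfolding drift_arc_def
  proof (intro exI conjI ballI)
    fix s assume "s \<in> {- b..- a}"
    then have s: "- s \<in> {a..b}" by auto
    note arc = arc[OF s]
    show "((\<lambda>s. pi/2 - \<beta> (- s)) has_real_derivative \<beta>' (- s)) (at s within {- b..- a})"
      using rev[of \<beta> \<beta>' s] arc by (auto intro!: derivative_eq_intros)
    show "((\<lambda>s. pi/2 - \<alpha> (- s)) has_real_derivative \<alpha>' (- s)) (at s within {- b..- a})"
      using rev[of \<alpha> \<alpha>' s] arc by (auto intro!: derivative_eq_intros)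
    show "((\<lambda>s. - \<theta> (- s)) has_real_derivative \<theta>' (- s)) (at s within {- b..- a})"
      using rev[of \<theta> \<theta>' s] arc by (auto intro!: derivative_eq_intros)
    show "0 < \<theta>' (- s)" using arc by blast
    show "\<bar>\<beta>' (- s) - \<theta>' (- s) * (A * (cos (pi/2 - \<beta> (- s)) * cos (pi/2 - \<alpha> (- s))))\<bar>
        + \<bar>\<alpha>' (- s) - \<theta>' (- s) * (A * (sin (pi/2 - \<beta> (- s)) * sin (pi/2 - \<alpha> (- s))))\<bar>
      \<le> \<theta>' (- s) * max 0 (1 - d * A * \<bar>sin (pi/2 - \<beta> (- s)) * cos (pi/2 - \<alpha> (- s))\<bar>)"
      using arc by (simp add: cos_diff sin_diff mult.commute add.commute)
  qed (use ab ends in auto)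
qed

text \<open>
  The coordinates \<open>(\<alpha>, \<beta>)\<close> centred at \<open>x0\<close> with axes \<open>e\<close> and \<open>f\<close> bring the flow and the strain into
  the form used for \<open>drift_arc\<close>. Orthogonality of \<open>e\<close> and \<open>f\<close> is not required.
\<close>

definition edge_chart :: "real^2 \<Rightarrow> real^2 \<Rightarrow> real^2 \<Rightarrow> bool" where
  "edge_chart x0 e f \<longleftrightarrow> norm e = 1 \<and> norm f = 1 \<and>
     (\<forall>\<alpha> \<beta>. let x = x0 + \<alpha> *\<^sub>R e + \<beta> *\<^sub>R f in
        V0 x = (cos \<alpha> * cos \<beta>) *\<^sub>R e + (sin \<alpha> * sin \<beta>) *\<^sub>R f \<and>
        \<bar>cos (x$1) * cos (x$2)\<bar> = \<bar>sin \<alpha> * cos \<beta>\<bar>)"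

lemma drift_arc_transport:
  assumes dA: "0 \<le> d" "0 \<le> A"
    and cont: "continuous_on spacetime g"
    and sub: "viscosity_subsolution (cell_hamiltonian d A) g"
    and chart: "edge_chart x0 e f"
    and arc: "drift_arc d A (\<alpha>0, \<beta>0) (\<alpha>1, \<beta>1) T"
    and t: "0 \<le> t"
  shows "g (x0 + \<alpha>1 *\<^sub>R e + \<beta>1 *\<^sub>R f, t + T) \<le> g (x0 + \<alpha>0 *\<^sub>R e + \<beta>0 *\<^sub>R f, t)"
proof -
  have T: "0 < T" by (rule drift_arc_duration_pos[OF arc])
  obtain \<alpha> \<alpha>' \<beta> \<beta>' \<theta> \<theta>' :: "real \<Rightarrow> real" and a b where ab: "a < b"
    and ends: "\<alpha> a = \<alpha>0" "\<beta> a = \<beta>0" "\<alpha> b = \<alpha>1" "\<beta> b = \<beta>1" "\<theta> b - \<theta> a = T"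
    and arc: "\<And>s. s \<in> {a..b} \<Longrightarrow> (\<alpha> has_real_derivative \<alpha>' s) (at s within {a..b}) \<and>
        (\<beta> has_real_derivative \<beta>' s) (at s within {a..b}) \<and>
        (\<theta> has_real_derivative \<theta>' s) (at s within {a..b}) \<and> 0 < \<theta>' s \<and>
        \<bar>\<alpha>' s - \<theta>' s * (A * (cos (\<alpha> s) * cos (\<beta> s)))\<bar> + \<bar>\<beta>' s - \<theta>' s * (A * (sin (\<alpha> s) * sin (\<beta> s)))\<bar>
          \<le> \<theta>' s * max 0 (1 - d * A * \<bar>sin (\<alpha> s) * cos (\<beta> s)\<bar>)"
    by (rule drift_arcE[OF arc]) blast
  define r where "r = (\<lambda>x::real^2. max 0 (1 - d * A * \<bar>cos (x$1) * cos (x$2)\<bar>))"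
  define \<gamma> where "\<gamma> = (\<lambda>s. x0 + \<alpha> s *\<^sub>R e + \<beta> s *\<^sub>R f)"
  have "g (\<gamma> b, (\<lambda>s. \<theta> s - \<theta> a + t) b) \<le> g (\<gamma> a, (\<lambda>s. \<theta> s - \<theta> a + t) a)"
  proof (rule subsolution_le_along_curve[OF cont sub])
    show "VA A x \<bullet> q + r x * norm q \<le> cell_hamiltonian d A x q" for x q
      unfolding r_def by (rule cell_hamiltonian_ge[OF dA])
    show "norm (VA A x - VA A y) \<le> (4 * A + 2 * d * A) * norm (x - y)" for x y
      by (rule VA_lipschitz[OF dA])
    show "\<bar>r x - r y\<bar> \<le> (4 * A + 2 * d * A) * norm (x - y)" for x y
      unfolding r_def by (rule VA_lipschitz[OF dA])
    fix s assume s: "s \<in> {a..b}"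
    show "(\<gamma> has_vector_derivative (\<alpha>' s *\<^sub>R e + \<beta>' s *\<^sub>R f)) (at s within {a..b})"
      unfolding \<gamma>_def using arc[OF s]
      by (auto intro!: derivative_eq_intros)
    show "((\<lambda>s. \<theta> s - \<theta> a + t) has_real_derivative \<theta>' s) (at s within {a..b})"
      using arc[OF s] by (auto intro!: derivative_eq_intros)
    show "0 < \<theta>' s" using arc[OF s] by blast
    have V: "VA A (\<gamma> s) = (A * (cos (\<alpha> s) * cos (\<beta> s))) *\<^sub>R e + (A * (sin (\<alpha> s) * sin (\<beta> s))) *\<^sub>R f"
      and r: "r (\<gamma> s) = max 0 (1 - d * A * \<bar>sin (\<alpha> s) * cos (\<beta> s)\<bar>)"
      using chart by (auto simp: edge_chart_def Let_def VA_def \<gamma>_def r_def scaleR_add_right)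
    have "\<alpha>' s *\<^sub>R e + \<beta>' s *\<^sub>R f - \<theta>' s *\<^sub>R VA A (\<gamma> s)
        = (\<alpha>' s - \<theta>' s * (A * (cos (\<alpha> s) * cos (\<beta> s)))) *\<^sub>R e
          + (\<beta>' s - \<theta>' s * (A * (sin (\<alpha> s) * sin (\<beta> s)))) *\<^sub>R f"
      by (simp add: V algebra_simps)
    also have "norm \<dots> \<le> \<bar>\<alpha>' s - \<theta>' s * (A * (cos (\<alpha> s) * cos (\<beta> s)))\<bar>
        + \<bar>\<beta>' s - \<theta>' s * (A * (sin (\<alpha> s) * sin (\<beta> s)))\<bar>"
      using chart by (intro norm_triangle_le) (simp add: edge_chart_def)
    finally show "norm (\<alpha>' s *\<^sub>R e + \<beta>' s *\<^sub>R f - \<theta>' s *\<^sub>R VA A (\<gamma> s)) \<le> \<theta>' s * r (\<gamma> s)"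
      using arc[OF s] unfolding r by linarith
  qed (use ab t T ends in auto)
  then show ?thesis using ends by (simp add: \<gamma>_def add.commute)
qed

text \<open>
  A curve along which the stream function \<open>cos \<alpha> sin \<beta>\<close> takes prescribed values \<open>w\<close>, with \<open>\<alpha>\<close> as the
  parameter and \<open>d\<alpha> = A cos \<alpha> cos \<beta> dt\<close>. The deviation from the flow is then \<open>A |w'|\<close> per unit of time.
  As \<open>|sin \<beta>| \<le> 1/2\<close>, the time is at most \<open>2 / A\<close> times the integral of \<open>1 / cos\<close>.
\<close>

lemma drift_arc_along_streamlines:
  fixes w w' :: "real \<Rightarrow> real"
  assumes A: "0 < A" and d: "0 \<le> d" and ab: "0 \<le> a" "a < b" "b < pi/2"
    and w: "\<And>s. s \<in> {a..b} \<Longrightarrow> (w has_real_derivative w' s) (at s within {a..b})"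
    and small: "\<And>s. s \<in> {a..b} \<Longrightarrow> 2 * \<bar>w s\<bar> \<le> cos s"
    and w': "\<And>s. s \<in> {a..b} \<Longrightarrow> A * \<bar>w' s\<bar> \<le> max 0 (1 - d * A * sin s)"
  obtains T where "drift_arc d A (a, arcsin (w a / cos a)) (b, arcsin (w b / cos b)) T"
    "T \<le> 2 / A * (ln ((1 + sin b) / cos b) - ln ((1 + sin a) / cos a))"
proof -
  define u where "u = (\<lambda>s. w s / cos s)"
  define \<theta>' where "\<theta>' = (\<lambda>s. 1 / (A * (cos s * cos (arcsin (u s)))))"
  have cos_pos: "0 < cos s" and sin_nn: "0 \<le> sin s" if "s \<in> {a..b}" for s
    using that ab by (auto intro!: cos_gt_zero_pi sin_ge_zero)
  have u: "\<bar>u s\<bar> \<le> 1/2" if "s \<in> {a..b}" for s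
    using small[OF that] cos_pos[OF that] by (simp add: u_def abs_divide field_simps)
  have u1: "-1 < u s" "u s < 1" if "s \<in> {a..b}" for s
    using u[OF that] by linarith+
  have cos_arc: "cos (arcsin (u s)) = sqrt (1 - (u s)\<^sup>2)" if "s \<in> {a..b}" for s
    using u1[OF that] by (intro cos_arcsin) auto
  have cos_arc_ge: "1/2 \<le> cos (arcsin (u s))" if "s \<in> {a..b}" for s
  proof -
    have "(u s)\<^sup>2 \<le> (1/2)\<^sup>2" using u[OF that] by (simp only: abs_le_square_iff[symmetric])
    then have "(1/2)\<^sup>2 \<le> 1 - (u s)\<^sup>2" by (simp add: power2_eq_square)
    then show ?thesis unfolding cos_arc[OF that] by (rule real_le_rsqrt)
  qed
  have contw: "continuous_on {a..b} w"
    using w by (meson DERIV_continuous continuous_on_eq_continuous_within)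
  have cont\<theta>: "continuous_on {a..b} \<theta>'"
  proof -
    have "cos s \<noteq> 0" "cos s * cos (arcsin (w s / cos s)) \<noteq> 0" "-1 \<le> w s / cos s" "w s / cos s \<le> 1"
      if "s \<in> {a..b}" for s
      using cos_pos[OF that] cos_arc_ge[OF that] u1[OF that] unfolding u_def by auto
    then show ?thesis
      unfolding \<theta>'_def u_def using contw A by (intro continuous_intros) auto
  qed
  define \<theta> where "\<theta> = (\<lambda>s. integral {a..s} \<theta>')"
  have \<theta>: "(\<theta> has_real_derivative \<theta>' s) (at s within {a..b})" if "s \<in> {a..b}" for s
    unfolding \<theta>_def by (rule integral_has_real_derivative[OF cont\<theta> that])
  define f' where "f' = (\<lambda>s. inverse (cos (arcsin (u s))) * ((w' s * cos s + w s * sin s) / (cos s)\<^sup>2))"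
  have f: "((\<lambda>s. arcsin (u s)) has_real_derivative f' s) (at s within {a..b})" if "s \<in> {a..b}" for s
  proof -
    have "(u has_real_derivative (w' s * cos s + w s * sin s) / (cos s)\<^sup>2) (at s within {a..b})"
      unfolding u_def using cos_pos[OF that] w[OF that]
      by (auto intro!: derivative_eq_intros simp: power2_eq_square)
    moreover have "(arcsin has_real_derivative inverse (cos (arcsin (u s)))) (at (u s))"
      unfolding cos_arc[OF that] using u1[OF that] by (rule DERIV_arcsin)
    ultimately show ?thesis
      unfolding f'_def by (rule DERIV_chain2[rotated])
  qed
  have arc: "drift_arc d A (a, arcsin (w a / cos a)) (b, arcsin (w b / cos b)) (\<theta> b - \<theta> a)"
    unfolding drift_arc_def
  proof (intro exI conjI ballI)
    fix s assume s: "s \<in> {a..b}"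
    note pos = cos_pos[OF s] cos_arc_ge[OF s]
    show "((\<lambda>s. s) has_real_derivative (\<lambda>_. 1) s) (at s within {a..b})"
      by (auto intro!: derivative_eq_intros)
    show "((\<lambda>s. arcsin (u s)) has_real_derivative f' s) (at s within {a..b})" by (rule f[OF s])
    show "(\<theta> has_real_derivative \<theta>' s) (at s within {a..b})" by (rule \<theta>[OF s])
    show \<theta>'_pos: "0 < \<theta>' s" using pos A by (simp add: \<theta>'_def)
    have 1: "\<theta>' s * (A * (cos s * cos (arcsin (u s)))) = 1"
      using pos A by (simp add: \<theta>'_def)
    have "sin (arcsin (u s)) = w s / cos s"
      using u1[OF s] by (simp add: u_def)
    then have 2: "f' s - \<theta>' s * (A * (sin s * sin (arcsin (u s)))) = \<theta>' s * (A * w' s)"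
      using pos A by (simp add: \<theta>'_def f'_def field_simps power2_eq_square)
    have "\<bar>\<theta>' s * (A * w' s)\<bar> = \<theta>' s * (A * \<bar>w' s\<bar>)"
      using \<theta>'_pos A by (simp add: abs_mult)
    also have "\<dots> \<le> \<theta>' s * max 0 (1 - d * A * sin s)"
      using \<theta>'_pos w'[OF s] by (intro mult_left_mono) auto
    also have "\<dots> \<le> \<theta>' s * max 0 (1 - d * A * \<bar>sin s * cos (arcsin (u s))\<bar>)"
    proof -
      have "\<bar>sin s * cos (arcsin (u s))\<bar> \<le> sin s"
        using sin_nn[OF s] by (simp add: abs_mult mult_left_le)
      then have "d * A * \<bar>sin s * cos (arcsin (u s))\<bar> \<le> d * A * sin s"
        using d A by (intro mult_left_mono) auto
      then show ?thesis using \<theta>'_pos by (intro mult_left_mono) auto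
    qed
    finally show "\<bar>(\<lambda>_. 1) s - \<theta>' s * (A * (cos s * cos (arcsin (u s))))\<bar>
        + \<bar>f' s - \<theta>' s * (A * (sin s * sin (arcsin (u s))))\<bar>
      \<le> \<theta>' s * max 0 (1 - d * A * \<bar>sin s * cos (arcsin (u s))\<bar>)"
      by (simp add: 1 2)
  qed (use ab in \<open>auto simp: u_def\<close>)
  have L: "((\<lambda>s. 2 / A * (1 / cos s)) has_integral
      2 / A * ln ((1 + sin b) / cos b) - 2 / A * ln ((1 + sin a) / cos a)) {a..b}"
  proof (rule fundamental_theorem_of_calculus)
    fix s assume s: "s \<in> {a..b}"
    have "1 + sin s > 0" using sin_nn[OF s] by linarith
    have "((\<lambda>s. ln ((1 + sin s) / cos s)) has_real_derivative 1 / cos s) (at s)"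
    proof -
      have "((\<lambda>s. (1 + sin s) / cos s) has_real_derivative
         (cos s * cos s + (1 + sin s) * sin s) / (cos s * cos s)) (at s)"
        using cos_pos[OF s] by (auto intro!: derivative_eq_intros)
      moreover have "(ln has_real_derivative inverse ((1 + sin s) / cos s)) (at ((1 + sin s) / cos s))"
        using cos_pos[OF s] \<open>1 + sin s > 0\<close> by (intro DERIV_ln) simp
      ultimately have "((\<lambda>s. ln ((1 + sin s) / cos s)) has_real_derivative
         inverse ((1 + sin s) / cos s) * ((cos s * cos s + (1 + sin s) * sin s) / (cos s * cos s))) (at s)"
        by (rule DERIV_chain2[rotated])
      also have "cos s * cos s + (1 + sin s) * sin s = 1 + sin s"
        using sin_cos_squared_add3[of s] by (simp add: algebra_simps)
      also have "inverse ((1 + sin s) / cos s) * ((1 + sin s) / (cos s * cos s)) = 1 / cos s"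
      proof -
        have "inverse (X / c) * (X / (c * c)) = 1 / c" if "0 < X" "0 < c" for X c :: real
          using that by (simp add: field_simps)
        then show ?thesis using cos_pos[OF s] \<open>1 + sin s > 0\<close> by blast
      qed
      finally show ?thesis .
    qed
    then have "((\<lambda>s. 2 / A * ln ((1 + sin s) / cos s)) has_real_derivative 2 / A * (1 / cos s)) (at s)"
      by (rule DERIV_cmult)
    then show "((\<lambda>s. 2 / A * ln ((1 + sin s) / cos s)) has_vector_derivative 2 / A * (1 / cos s))
        (at s within {a..b})"
      by (simp add: has_real_derivative_iff_has_vector_derivative has_vector_derivative_at_within)
  qed (use ab in auto)
  have "\<theta> b - \<theta> a = integral {a..b} \<theta>'" by (simp add: \<theta>_def)
  also have "\<dots> \<le> integral {a..b} (\<lambda>s. 2 / A * (1 / cos s))"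
  proof (rule integral_le)
    show "\<theta>' integrable_on {a..b}" by (rule integrable_continuous_interval[OF cont\<theta>])
    show "(\<lambda>s. 2 / A * (1 / cos s)) integrable_on {a..b}" using L by (rule has_integral_integrable)
    fix s assume s: "s \<in> {a..b}"
    have "\<theta>' s \<le> 1 / (A * (cos s * (1/2)))"
      unfolding \<theta>'_def using cos_pos[OF s] cos_arc_ge[OF s] A
      by (intro divide_left_mono mult_left_mono mult_pos_pos) auto
    then show "\<theta>' s \<le> 2 / A * (1 / cos s)" by simp
  qed
  also have "\<dots> = 2 / A * (ln ((1 + sin b) / cos b) - ln ((1 + sin a) / cos a))"
    using integral_unique[OF L] by (simp add: right_diff_distrib)
  finally show thesis by (rule that[OF arc])
qed

section \<open>Travelling through the lattice of cells\<close>

text \<open>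
  The first half of a turn. For \<open>\<alpha> \<le> \<pi>/6\<close> the burning speed is at least \<open>1 - 101/200 > 2/5\<close>, which allows
  the stream function to grow to \<open>c = 1 / (5 A)\<close>; from there the curve follows the streamline up to
  the diagonal \<open>\<alpha> + \<beta> = \<pi>/2\<close>, where \<open>cos \<alpha> = sqrt c\<close>. Passing this close to the corner costs the logarithm.
\<close>

lemma quarter_turn_arcs:
  assumes A: "19 < A" and d: "0 \<le> d" "d * A \<le> 101/100"
  obtains m D T1 T2 where "drift_arc d A (0, 0) (pi/6, m) T1"
    "drift_arc d A (pi/6, m) (D, pi/2 - D) T2" "T1 + T2 \<le> 3 * ln A / A"
proof -
  define c where "c = 1 / (5 * A)"
  define D where "D = arccos (sqrt c)"
  define L where "L = (\<lambda>s::real. ln ((1 + sin s) / cos s))"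
  have c: "0 < c" "c < 1/4" using A by (auto simp: c_def field_simps)
  have "sqrt c < 1/2"
    by (rule real_less_lsqrt) (use c in \<open>auto simp: power2_eq_square\<close>)
  with c have sc: "0 < sqrt c" "sqrt c < 1/2" by simp_all
  have cos30: "1/2 \<le> cos (pi/6)"
    unfolding cos_30 by (simp add: real_le_rsqrt)
  have cosD: "cos D = sqrt c" unfolding D_def using sc by (intro cos_arccos) linarith+
  have "arccos (cos (pi/6)) < D" "D < arccos 0"
    unfolding D_def using sc cos30 cos_le_one[of "pi/6"] by (intro arccos_less_arccos; linarith)+
  moreover have "arccos (cos (pi/6)) = pi/6" by (rule arccos_cos) auto
  ultimately have D: "pi/6 < D" "D < pi/2" by simp_all
  obtain T1 where T1: "drift_arc d A (0, arcsin (2 / (5 * A) * sin 0 / cos 0))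
      (pi/6, arcsin (2 / (5 * A) * sin (pi/6) / cos (pi/6))) T1"
    "T1 \<le> 2 / A * (L (pi/6) - L 0)"
    unfolding L_def
  proof (rule drift_arc_along_streamlines[of A d 0 "pi/6" "\<lambda>s. 2 / (5 * A) * sin s" "\<lambda>s. 2 / (5 * A) * cos s"])
    fix s :: real assume s: "s \<in> {0..pi/6}"
    then have "sin s \<le> sin (pi/6)" "cos (pi/6) \<le> cos s" "0 \<le> sin s"
      by (auto intro!: sin_monotone_2pi_le cos_monotone_0_pi_le sin_ge_zero)
    then have sin: "0 \<le> sin s" "sin s \<le> 1/2" and cos: "1/2 \<le> cos s"
      using cos30 by (auto simp: sin_30)
    show "((\<lambda>s. 2 / (5 * A) * sin s) has_real_derivative 2 / (5 * A) * cos s) (at s within {0..pi/6})"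
      by (rule derivative_eq_intros refl)+ simp
    have "2 / (5 * A) * sin s \<le> 1/2 * (1/2)"
      using sin A by (intro mult_mono) (auto simp: field_simps)
    moreover have "0 \<le> 2 / (5 * A) * sin s" using sin A by simp
    ultimately show "2 * \<bar>2 / (5 * A) * sin s\<bar> \<le> cos s"
      using cos by linarith
    have "A * \<bar>2 / (5 * A) * cos s\<bar> = 2/5 * cos s"
      using cos A by (simp add: abs_mult)
    also have "\<dots> \<le> 2/5" by simp
    also have "\<dots> \<le> 1 - 101/100 * (1/2)" by simp
    also have "\<dots> \<le> 1 - d * A * sin s"
      using sin d A by (intro diff_left_mono mult_mono) auto
    finally show "A * \<bar>2 / (5 * A) * cos s\<bar> \<le> max 0 (1 - d * A * sin s)" by linarith
  qed (use A d in auto)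
  obtain T2 where T2: "drift_arc d A (pi/6, arcsin (c / cos (pi/6))) (D, arcsin (c / cos D)) T2"
    "T2 \<le> 2 / A * (L D - L (pi/6))"
    unfolding L_def
  proof (rule drift_arc_along_streamlines[of A d "pi/6" D "\<lambda>_. c" "\<lambda>_. 0"])
    fix s :: real assume s: "s \<in> {pi/6..D}"
    have "cos D \<le> cos s" using s D by (intro cos_monotone_0_pi_le) auto
    moreover have "2 * c \<le> sqrt c"
    proof -
      have "sqrt c * sqrt c \<le> sqrt c * (1/2)" using sc by (intro mult_left_mono) auto
      then show ?thesis using c by simp
    qed
    ultimately show "2 * \<bar>c\<bar> \<le> cos s" using c by (simp add: cosD)
  qed (use A d D in auto)
  have mid: "2 / (5 * A) * sin (pi/6) = c" by (simp add: sin_30 c_def)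
  have "c / cos D = sqrt c" unfolding cosD using c by (simp add: real_div_sqrt)
  moreover have "arcsin (sqrt c) = pi/2 - D"
    unfolding D_def using sc by (intro arcsin_arccos_eq) linarith+
  ultimately have endD: "arcsin (c / cos D) = pi/2 - D" by simp
  have "T1 + T2 \<le> 2 / A * L D"
    using T1(2) T2(2) by (simp add: right_diff_distrib L_def)
  also have "L D \<le> ln (2 / sqrt c)"
    unfolding L_def cosD using sc D sin_gt_zero[of D]
    by (intro ln_mono divide_right_mono divide_pos_pos) (auto simp: add_pos_pos)
  also have "ln (2 / sqrt c) = ln (20 * A) / 2"
  proof -
    have "2 / sqrt c = 2 * sqrt (5 * A)" by (simp add: c_def real_sqrt_divide)
    also have "\<dots> = sqrt (4 * (5 * A))" by (simp only: real_sqrt_mult real_sqrt_four)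
    finally have "2 / sqrt c = sqrt (20 * A)" by simp
    then show ?thesis using A by (simp add: ln_sqrt)
  qed
  also have "ln (20 * A) / 2 \<le> ln (A ^ 3) / 2"
  proof -
    have "20 * A \<le> (A * A) * A"
      using A mult_mono[of 19 A 19 A] by (intro mult_right_mono) auto
    then show ?thesis using A by (simp add: power3_eq_cube)
  qed
  also have "ln (A ^ 3) / 2 = 3/2 * ln A" using A by (simp add: ln_realpow)
  finally have "T1 + T2 \<le> 2 / A * (3/2 * ln A)" using A by (simp add: field_simps)
  then have "T1 + T2 \<le> 3 * ln A / A" by simp
  with T1(1) T2(1) show thesis
    unfolding mid endD by (intro that) simp_all
qed

text \<open>
  At the midpoint \<open>(u, v)\<close> of a horizontal edge the flow has direction \<open>\<eta> = \<plusminus>1\<close> along the edge; the sign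
  \<open>\<sigma>\<close> selects the side of the edge.
\<close>

lemma horizontal_edge_chart:
  assumes uv: "cos u = 0" "sin v = 0" and \<eta>: "\<eta> = - sin u * cos v" "\<bar>\<eta>\<bar> = 1" and "\<bar>\<sigma>\<bar> = 1"
  shows "edge_chart (vector [u, v]) (vector [\<eta>, 0]) (vector [0, \<sigma>])"
proof -
  have cases: "\<eta> = 1 \<or> \<eta> = -1" "\<sigma> = 1 \<or> \<sigma> = -1" using assms by linarith+
  have "(sin u)\<^sup>2 = 1" "(cos v)\<^sup>2 = 1"
    using uv sin_cos_squared_add[of u] sin_cos_squared_add[of v] by simp_all
  then have sgn: "sin u = 1 \<or> sin u = -1" "cos v = 1 \<or> cos v = -1"
    by (simp_all add: power2_eq_1_iff)
  have n: "norm (vector [\<eta>, 0] :: real^2) = 1" "norm (vector [0, \<sigma>] :: real^2) = 1"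
    using cases by (auto simp: norm_eq_sqrt_inner inner_vec2)
  show ?thesis
    unfolding edge_chart_def Let_def
    using n cases sgn uv \<eta>(1)
    by (auto simp: V0_def vec_eq_iff forall_2 sin_add cos_add sin_diff cos_diff)
qed

lemma vertical_edge_chart:
  assumes uv: "sin u = 0" "cos v = 0" and \<eta>: "\<eta> = cos u * sin v" "\<bar>\<eta>\<bar> = 1" and "\<bar>\<sigma>\<bar> = 1"
  shows "edge_chart (vector [u, v]) (vector [0, \<eta>]) (vector [\<sigma>, 0])"
proof -
  have cases: "\<eta> = 1 \<or> \<eta> = -1" "\<sigma> = 1 \<or> \<sigma> = -1" using assms by linarith+
  have "(cos u)\<^sup>2 = 1" "(sin v)\<^sup>2 = 1"
    using uv sin_cos_squared_add[of u] sin_cos_squared_add[of v] by simp_all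
  then have sgn: "cos u = 1 \<or> cos u = -1" "sin v = 1 \<or> sin v = -1"
    by (simp_all add: power2_eq_1_iff)
  have n: "norm (vector [0, \<eta>] :: real^2) = 1" "norm (vector [\<sigma>, 0] :: real^2) = 1"
    using cases by (auto simp: norm_eq_sqrt_inner inner_vec2)
  show ?thesis
    unfolding edge_chart_def Let_def
    using n cases sgn uv \<eta>(1)
    by (auto simp: V0_def vec_eq_iff forall_2 sin_add cos_add sin_diff cos_diff mult.commute)
qed

text \<open>
  The half-period lattice. Nodes \<open>(i, j)\<close> with \<open>i + j\<close> odd are midpoints of edges, horizontal ones for
  odd \<open>i\<close>; those with \<open>i\<close> and \<open>j\<close> even are corners of cells. Translation by a period changes an index by \<open>4\<close>.
\<close>

definition node :: "int \<Rightarrow> int \<Rightarrow> real^2" where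
  "node i j = vector [of_int i * (pi/2), of_int j * (pi/2)]"

lemma trig_odd_node:
  "cos (of_int (2 * n + 1) * (pi/2)) = 0" "sin (of_int (2 * n + 1) * (pi/2)) = (if even n then 1 else -1)"
proof -
  have eq: "of_int (2 * n + 1) * (pi/2) = pi * of_int n + pi/2" by (simp add: algebra_simps)
  show "cos (of_int (2 * n + 1) * (pi/2)) = 0" "sin (of_int (2 * n + 1) * (pi/2)) = (if even n then 1 else -1)"
    unfolding eq by (simp_all add: cos_add sin_add)
qed

lemma trig_even_node:
  "sin (of_int (2 * n) * (pi/2)) = 0" "cos (of_int (2 * n) * (pi/2)) = (if even n then 1 else -1)"
proof -
  have eq: "of_int (2 * n) * (pi/2) = pi * of_int n" by simp
  show "sin (of_int (2 * n) * (pi/2)) = 0" "cos (of_int (2 * n) * (pi/2)) = (if even n then 1 else -1)"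
    unfolding eq by simp_all
qed

text \<open>
  Solutions of the equation with \<open>\<epsilon> = 1\<close>. The upper bounds on \<open>d\<close> and \<open>A d\<close> enter only through
  \<open>d A \<le> 101/100\<close> and \<open>19 < A\<close>.
\<close>

locale cell_flow_solution =
  fixes d A :: real and p :: "real^2" and g :: "(real^2) \<times> real \<Rightarrow> real"
  assumes d_pos: "0 < d" and Ad: "sqrt (1 + 4 * d\<^sup>2) < A * d" and Ad_le: "d * A \<le> 101/100"
    and A_gt: "19 < A" and norm_p: "norm p = 1"
    and cont: "continuous_on spacetime g"
    and sub: "viscosity_subsolution (cell_hamiltonian d A) g"
    and super: "viscosity_supersolution (cell_hamiltonian d A) g"
    and init: "\<And>x. g (x, 0) = p \<bullet> x"
    and periodic: "\<And>x (k::int^2) t. 0 \<le> t \<Longrightarrow>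
      g (x + (2 * pi) *\<^sub>R (\<chi> i. of_int (k$i)), t) = g (x, t) + p \<bullet> ((2 * pi) *\<^sub>R (\<chi> i. of_int (k$i)))"
begin

text \<open>
  The value of \<open>g\<close> does not increase on passing from \<open>x\<close> to \<open>y\<close> in time \<open>T\<close>.
\<close>

definition reach :: "real^2 \<Rightarrow> real^2 \<Rightarrow> real \<Rightarrow> bool" where
  "reach x y T \<longleftrightarrow> (\<forall>t\<ge>0. g (y, t + T) \<le> g (x, t))"

lemma reach_trans:
  assumes "reach x y S" "reach y z T" "0 \<le> S"
  shows "reach x z (S + T)"
  unfolding reach_def
proof (intro allI impI)
  fix t :: real assume "0 \<le> t"
  have "g (z, (t + S) + T) \<le> g (y, t + S)"
    using assms \<open>0 \<le> t\<close> by (auto simp: reach_def)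
  also have "\<dots> \<le> g (x, t)" using assms \<open>0 \<le> t\<close> by (auto simp: reach_def)
  finally show "g (z, t + (S + T)) \<le> g (x, t)" by (simp add: add.assoc)
qed

lemma reach_arc:
  assumes "edge_chart x0 e f" "drift_arc d A (\<alpha>0, \<beta>0) (\<alpha>1, \<beta>1) T"
  shows "reach (x0 + \<alpha>0 *\<^sub>R e + \<beta>0 *\<^sub>R f) (x0 + \<alpha>1 *\<^sub>R e + \<beta>1 *\<^sub>R f) T"
  unfolding reach_def
  using drift_arc_transport[OF _ _ cont sub assms] d_pos A_gt by auto

lemma quarter_turn:
  obtains \<tau> where "0 < \<tau>" "\<tau> \<le> 6 * ln A / A"
    "\<And>x0 e f. edge_chart x0 e f \<Longrightarrow> reach x0 (x0 + (pi/2) *\<^sub>R e + (pi/2) *\<^sub>R f) \<tau>"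
proof -
  obtain m D T1 T2 where arcs: "drift_arc d A (0, 0) (pi/6, m) T1"
    "drift_arc d A (pi/6, m) (D, pi/2 - D) T2" "T1 + T2 \<le> 3 * ln A / A"
    by (rule quarter_turn_arcs[OF A_gt _ Ad_le]) (use d_pos in auto)
  have T: "0 < T1" "0 < T2" using arcs drift_arc_duration_pos by blast+
  \<comment> \<open>the second half of the turn is the mirror image of the first\<close>
  have mirrored: "drift_arc d A (D, pi/2 - D) (pi/2 - m, pi/2 - pi/6) T2"
    "drift_arc d A (pi/2 - m, pi/2 - pi/6) (pi/2, pi/2) T1"
    using drift_arc_mirror[OF arcs(1)] drift_arc_mirror[OF arcs(2)] by simp_all
  have "reach x0 (x0 + (pi/2) *\<^sub>R e + (pi/2) *\<^sub>R f) (T1 + (T2 + (T2 + T1)))"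
    if "edge_chart x0 e f" for x0 e f
    using reach_trans[OF reach_arc[OF that arcs(1)]
        reach_trans[OF reach_arc[OF that arcs(2)]
          reach_trans[OF reach_arc[OF that mirrored(1)] reach_arc[OF that mirrored(2)]]]] T
    by simp
  then show thesis
    by (rule that[rotated 2]) (use T arcs(3) in auto)
qed

text \<open>
  Loops modulo periods through \<open>x_f\<close>. The index computations below record the sign of the flow on each edge,
  which alternates like the parity of \<open>m + n\<close>. The eastward loop is longer because the flow at \<open>x_f\<close>
  points west.
\<close>

lemma loops:
  obtains \<tau> where "0 < \<tau>" "\<tau> \<le> 6 * ln A / A"
    "reach (node 1 0) (node 5 0) (8 * \<tau>)"
    "reach (node 1 0) (node (-3) 0) (4 * \<tau>)"
    "reach (node 1 0) (node 1 4) (4 * \<tau>)"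
    "reach (node 1 0) (node 1 (-4)) (4 * \<tau>)"
proof -
  obtain \<tau> where \<tau>: "0 < \<tau>" "\<tau> \<le> 6 * ln A / A"
    and turn: "\<And>x0 e f. edge_chart x0 e f \<Longrightarrow> reach x0 (x0 + (pi/2) *\<^sub>R e + (pi/2) *\<^sub>R f) \<tau>"
    by (rule quarter_turn) blast
  have h: "reach (node (2 * m + 1) (2 * n)) (node (2 * m + 1 + (if even (m + n) then -1 else 1)) (2 * n + \<sigma>)) \<tau>"
    if "\<sigma> = 1 \<or> \<sigma> = -1" for m n \<sigma> :: int
  proof -
    let ?\<eta> = "if even (m + n) then -1 else 1 :: int"
    have "edge_chart (node (2 * m + 1) (2 * n)) (vector [of_int ?\<eta>, 0]) (vector [0, of_int \<sigma>])"
      unfolding node_def using that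
      by (intro horizontal_edge_chart) (auto simp only: trig_odd_node trig_even_node, auto)
    moreover have "node (2 * m + 1) (2 * n) + (pi/2) *\<^sub>R vector [of_int ?\<eta>, 0] + (pi/2) *\<^sub>R vector [0, of_int \<sigma>]
        = node (2 * m + 1 + ?\<eta>) (2 * n + \<sigma>)"
      by (simp add: node_def vec_eq_iff forall_2 algebra_simps)
    ultimately show ?thesis using turn by metis
  qed
  have v: "reach (node (2 * m) (2 * n + 1)) (node (2 * m + \<sigma>) (2 * n + 1 + (if even (m + n) then 1 else -1))) \<tau>"
    if "\<sigma> = 1 \<or> \<sigma> = -1" for m n \<sigma> :: int
  proof -
    let ?\<eta> = "if even (m + n) then 1 else -1 :: int"
    have "edge_chart (node (2 * m) (2 * n + 1)) (vector [0, of_int ?\<eta>]) (vector [of_int \<sigma>, 0])"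
      unfolding node_def using that
      by (intro vertical_edge_chart) (auto simp only: trig_odd_node trig_even_node, auto)
    moreover have "node (2 * m) (2 * n + 1) + (pi/2) *\<^sub>R vector [0, of_int ?\<eta>] + (pi/2) *\<^sub>R vector [of_int \<sigma>, 0]
        = node (2 * m + \<sigma>) (2 * n + 1 + ?\<eta>)"
      by (simp add: node_def vec_eq_iff forall_2 algebra_simps)
    ultimately show ?thesis using turn by metis
  qed
  note step = reach_trans[OF _ _ less_imp_le[OF \<open>0 < \<tau>\<close>]]
  have up1: "reach (node 1 0) (node 0 1) \<tau>" and down1: "reach (node 1 0) (node 0 (-1)) \<tau>"
    using h[of 1 0 0] h[of "-1" 0 0] by simp_all
  have right: "reach (node 0 1) (node 1 2) \<tau>" "reach (node 1 2) (node 2 1) \<tau>"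
    "reach (node 2 1) (node 3 0) \<tau>" "reach (node 3 0) (node 4 1) \<tau>"
    "reach (node 4 1) (node 5 2) \<tau>" "reach (node 5 2) (node 6 1) \<tau>" "reach (node 6 1) (node 5 0) \<tau>"
    using v[of 1 0 0] h[of "-1" 0 1] v[of 1 1 0] h[of 1 1 0] v[of 1 2 0] h[of "-1" 2 1] v[of "-1" 3 0]
    by simp_all
  have left: "reach (node 0 1) (node (-1) 2) \<tau>" "reach (node (-1) 2) (node (-2) 1) \<tau>"
    "reach (node (-2) 1) (node (-3) 0) \<tau>"
    using v[of "-1" 0 0] h[of "-1" "-1" 1] v[of "-1" "-1" 0] by simp_all
  have up: "reach (node 1 2) (node 2 3) \<tau>" "reach (node 2 3) (node 1 4) \<tau>"
    using h[of 1 0 1] v[of "-1" 1 1] by simp_all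
  have down: "reach (node 0 (-1)) (node 1 (-2)) \<tau>" "reach (node 1 (-2)) (node 2 (-3)) \<tau>"
    "reach (node 2 (-3)) (node 1 (-4)) \<tau>"
    using v[of 1 0 "-1"] h[of "-1" 0 "-1"] v[of "-1" 1 "-2"] by simp_all
  show thesis
  proof (rule that[OF \<tau>])
    show "reach (node 1 0) (node 5 0) (8 * \<tau>)"
      using step[OF up1 step[OF right(1) step[OF right(2) step[OF right(3) step[OF right(4)
        step[OF right(5) step[OF right(6,7)]]]]]]] by simp
    show "reach (node 1 0) (node (-3) 0) (4 * \<tau>)"
      using step[OF up1 step[OF left(1) step[OF left(2,3)]]] by simp
    show "reach (node 1 0) (node 1 4) (4 * \<tau>)"
      using step[OF up1 step[OF right(1) step[OF up]]] by simp
    show "reach (node 1 0) (node 1 (-4)) (4 * \<tau>)"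
      using step[OF down1 step[OF down(1) step[OF down(2,3)]]] by simp
  qed
qed

lemma x_f_node: "x_f = node 1 0"
  by (simp add: x_f_def node_def)

lemma periodic_node:
  assumes "0 \<le> t"
  shows "g (node (1 + 4 * k) (4 * l), t) = g (x_f, t) + 2 * pi * (p$1 * of_int k + p$2 * of_int l)"
proof -
  have "node (1 + 4 * k) (4 * l) = x_f + (2 * pi) *\<^sub>R (\<chi> i. of_int ((vector [k, l] :: int^2) $ i))"
    by (simp add: node_def x_f_def vec_eq_iff forall_2 algebra_simps)
  then show ?thesis
    using periodic[OF assms, of x_f "vector [k, l]"] by (simp add: inner_vec2 algebra_simps)
qed

lemma descent_at_x_f:
  obtains P where "0 < P" "P \<le> 48 * ln A / A" "\<And>t. 0 \<le> t \<Longrightarrow> g (x_f, t + P) \<le> g (x_f, t) - pi"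
proof -
  obtain \<tau> where \<tau>: "0 < \<tau>" "\<tau> \<le> 6 * ln A / A"
    and loops: "reach (node 1 0) (node 5 0) (8 * \<tau>)" "reach (node 1 0) (node (-3) 0) (4 * \<tau>)"
      "reach (node 1 0) (node 1 4) (4 * \<tau>)" "reach (node 1 0) (node 1 (-4)) (4 * \<tau>)"
    by (rule loops)
  have per: "g (node 5 0, t) = g (x_f, t) + 2 * pi * p$1" "g (node (-3) 0, t) = g (x_f, t) + 2 * pi * - p$1"
    "g (node 1 4, t) = g (x_f, t) + 2 * pi * p$2" "g (node 1 (-4), t) = g (x_f, t) + 2 * pi * - p$2"
    if "0 \<le> t" for t
    using periodic_node[OF that, of 1 0] periodic_node[OF that, of "-1" 0]
      periodic_node[OF that, of 0 1] periodic_node[OF that, of 0 "-1"] by simp_all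
  note loops = loops[unfolded reach_def x_f_node[symmetric], rule_format]
  have east: "g (x_f, t + 8 * \<tau>) \<le> g (x_f, t) - 2 * pi * p$1"
    and west: "g (x_f, t + 4 * \<tau>) \<le> g (x_f, t) - 2 * pi * - p$1"
    and north: "g (x_f, t + 4 * \<tau>) \<le> g (x_f, t) - 2 * pi * p$2"
    and south: "g (x_f, t + 4 * \<tau>) \<le> g (x_f, t) - 2 * pi * - p$2" if t: "0 \<le> t" for t
  proof -
    have "0 \<le> t + 8 * \<tau>" "0 \<le> t + 4 * \<tau>" using t \<tau>(1) by simp_all
    then show "g (x_f, t + 8 * \<tau>) \<le> g (x_f, t) - 2 * pi * p$1"
      "g (x_f, t + 4 * \<tau>) \<le> g (x_f, t) - 2 * pi * - p$1"
      "g (x_f, t + 4 * \<tau>) \<le> g (x_f, t) - 2 * pi * p$2"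
      "g (x_f, t + 4 * \<tau>) \<le> g (x_f, t) - 2 * pi * - p$2"
      using loops[OF t] per by (simp_all only:)
  qed
  have "1/2 \<le> \<bar>p$1\<bar> \<or> 1/2 \<le> \<bar>p$2\<bar>"
  proof (rule ccontr)
    assume "\<not> ?thesis"
    moreover have "norm p \<le> \<bar>p$1\<bar> + \<bar>p$2\<bar>"
      using norm_le_l1_cart[of p] by (simp add: sum_2)
    ultimately show False using norm_p by simp
  qed
  then have dir: "1/2 \<le> p$1 \<or> 1/2 \<le> - p$1 \<or> 1/2 \<le> p$2 \<or> 1/2 \<le> - p$2" by linarith
  have "g (x_f, t + 8 * \<tau>) \<le> g (x_f, t) - pi" if t: "0 \<le> t" for t
  proof -
    have t': "0 \<le> t + 4 * \<tau>" and twice: "t + 4 * \<tau> + 4 * \<tau> = t + 8 * \<tau>"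
      using t \<tau> by simp_all
    have half: "pi \<le> 2 * pi * r" if "1/2 \<le> r" for r
      using mult_left_mono[OF that, of "2 * pi"] by simp
    from dir show ?thesis
      using east[OF t] west[OF t] west[OF t', unfolded twice] north[OF t] north[OF t', unfolded twice]
        south[OF t] south[OF t', unfolded twice] half[of "p$1"] half[of "- p$1"] half[of "p$2"] half[of "- p$2"]
        pi_gt_zero
      by (elim disjE) linarith+
  qed
  then show thesis
    by (rule that[rotated 2]) (use \<tau> in auto)
qed

text \<open>
  The exact flow on the separatrix, \<open>sin \<alpha> = tanh (A t)\<close>. It reaches the midpoint of the edge after any
  prescribed time and starts within half an edge of it, which bounds \<open>g (x_f, s)\<close> for all \<open>s\<close> independently
  of the solution.
\<close>

lemma separatrix_arc:
  assumes "0 < s"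
  shows "drift_arc d A (arcsin (tanh (- A * s)), 0) (0, 0) s"
  unfolding drift_arc_def
proof (intro exI conjI ballI)
  fix t assume "t \<in> {- s..0}"
  have th: "-1 < tanh (A * t)" "tanh (A * t) < 1"
    using tanh_real_bounds[of "A * t"] by auto
  then have "(tanh (A * t))\<^sup>2 < 1" by (simp add: abs_square_less_1 abs_if)
  then have pos: "0 < 1 - (tanh (A * t))\<^sup>2" by simp
  have cos: "cos (arcsin (tanh (A * t))) = sqrt (1 - (tanh (A * t))\<^sup>2)"
    using th by (intro cos_arcsin) auto
  have "cosh (A * t) \<noteq> 0" by simp
  then have "((\<lambda>t. tanh (A * t)) has_real_derivative (1 - (tanh (A * t))\<^sup>2) * A) (at t)"
    by (auto intro!: derivative_eq_intros)
  from DERIV_chain2[OF DERIV_arcsin[OF th] this]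
  have "((\<lambda>t. arcsin (tanh (A * t))) has_real_derivative
      inverse (sqrt (1 - (tanh (A * t))\<^sup>2)) * ((1 - (tanh (A * t))\<^sup>2) * A)) (at t)" .
  also have "inverse (sqrt (1 - (tanh (A * t))\<^sup>2)) * ((1 - (tanh (A * t))\<^sup>2) * A)
      = A * cos (arcsin (tanh (A * t)))"
    unfolding cos using pos by (simp add: real_div_sqrt divide_inverse[symmetric] mult.commute)
  finally show "((\<lambda>t. arcsin (tanh (A * t))) has_real_derivative A * cos (arcsin (tanh (A * t))))
      (at t within {- s..0})" by (rule has_field_derivative_at_within)
  show "((\<lambda>_. 0) has_real_derivative 0) (at t within {- s..0})" by simp
  show "((\<lambda>t. t) has_real_derivative 1) (at t within {- s..0})" by simp
  show "\<bar>A * cos (arcsin (tanh (A * t))) - 1 * (A * (cos (arcsin (tanh (A * t))) * cos 0))\<bar>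
      + \<bar>0 - 1 * (A * (sin (arcsin (tanh (A * t))) * sin 0))\<bar>
    \<le> 1 * max 0 (1 - d * A * \<bar>sin (arcsin (tanh (A * t))) * cos 0\<bar>)" by simp
qed (use assms in auto)

lemma bounded_at_x_f:
  assumes "0 \<le> s"
  shows "g (x_f, s) \<le> pi"
proof (cases "s = 0")
  case True
  then show ?thesis
    using init norm_p Cauchy_Schwarz_ineq2[of p x_f] norm_le_l1_cart[of x_f] pi_gt_zero
    by (simp add: sum_2 x_f_def)
next
  case False
  then have s: "0 < s" using assms by simp
  define \<alpha> where "\<alpha> = arcsin (tanh (- A * s))"
  let ?e = "vector [-1, 0] :: real^2" and ?f = "vector [0, 1] :: real^2"
  have "edge_chart x_f ?e ?f"
    unfolding x_f_def by (rule horizontal_edge_chart) auto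
  from reach_arc[OF this separatrix_arc[OF s]]
  have "reach (x_f + \<alpha> *\<^sub>R ?e + 0 *\<^sub>R ?f) (x_f + 0 *\<^sub>R ?e + 0 *\<^sub>R ?f) s" unfolding \<alpha>_def .
  from this[unfolded reach_def, rule_format, of 0]
  have "g (x_f, s) \<le> g (x_f + \<alpha> *\<^sub>R ?e, 0)" by simp
  also have "\<dots> \<le> norm (x_f + \<alpha> *\<^sub>R ?e)"
    using init norm_p Cauchy_Schwarz_ineq2[of p "x_f + \<alpha> *\<^sub>R ?e"] by simp
  also have "\<dots> \<le> \<bar>pi/2 - \<alpha>\<bar>"
    using norm_le_l1_cart[of "x_f + \<alpha> *\<^sub>R ?e"] by (simp add: sum_2 x_f_def)
  also have "\<dots> \<le> pi"
  proof -
    have "-1 \<le> tanh (- A * s)" "tanh (- A * s) \<le> 1"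
      using tanh_real_bounds[of "- A * s"] by (auto simp del: tanh_minus)
    then show ?thesis using arcsin_bounded[of "tanh (- A * s)"] unfolding \<alpha>_def by linarith
  qed
  finally show ?thesis .
qed

lemma upper_bound_at_x_f:
  assumes "0 \<le> T"
  shows "g (x_f, T) \<le> 2 * pi - 1/16 * (A / ln A) * T"
proof -
  obtain P where P: "0 < P" "P \<le> 48 * ln A / A" "\<And>t. 0 \<le> t \<Longrightarrow> g (x_f, t + P) \<le> g (x_f, t) - pi"
    by (rule descent_at_x_f) blast
  have iter: "g (x_f, s + of_nat n * P) \<le> g (x_f, s) - of_nat n * pi" if "0 \<le> s" for s n
  proof (induction n)
    case (Suc n)
    have "g (x_f, (s + of_nat n * P) + P) \<le> g (x_f, s + of_nat n * P) - pi"
      using that P(1) by (intro P(3)) auto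
    with Suc show ?case by (simp add: algebra_simps)
  qed simp
  define n where "n = nat \<lfloor>T / P\<rfloor>"
  have "0 \<le> T / P" using assms P(1) by simp
  then have n: "of_nat n \<le> T / P" "T / P < of_nat n + 1"
    unfolding n_def by (simp_all add: floor_le_iff)
  then have "0 \<le> T - of_nat n * P" using P(1) by (simp add: field_simps)
  then have "g (x_f, T) \<le> g (x_f, T - of_nat n * P) - of_nat n * pi"
    using iter[of "T - of_nat n * P" n] by simp
  also have "\<dots> \<le> pi - of_nat n * pi"
    using bounded_at_x_f[OF \<open>0 \<le> T - of_nat n * P\<close>] by simp
  also have "\<dots> \<le> pi - (T / P - 1) * pi"
    using n(2) by (intro diff_left_mono mult_right_mono) auto
  also have "\<dots> \<le> 2 * pi - 1/16 * (A / ln A) * T"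
  proof -
    have "0 < ln A" using A_gt by simp
    have "3 * (T / (48 * ln A / A)) \<le> pi * (T / P)"
      using P assms pi_gt3 A_gt \<open>0 < ln A\<close>
      by (intro mult_mono divide_left_mono mult_pos_pos divide_pos_pos) auto
    then show ?thesis using A_gt \<open>0 < ln A\<close> by (simp add: algebra_simps)
  qed
  finally show ?thesis .
qed

lemma saddle_edge_gap:
  assumes "0 \<le> T"
  shows "1/16 * (A / ln A) * T - (4 * pi + 1) \<le> g (x_s, T) - g (x_f, T)"
  using upper_bound_at_x_f[OF assms]
    supersolution_lower_bound[OF d_pos Ad cont super init norm_p assms] by linarith

end

section \<open>The gap and the failure of convergence\<close>

text \<open>
  The bound \<open>19 < A\<close> comes from \<open>A d > 1\<close> and \<open>d < 20/399\<close>.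
\<close>

lemma cell_flow_solution_rescale:
  assumes d: "0 < d" "d < 20/399" and Ad: "sqrt (1 + 4 * d\<^sup>2) < A * d" "A * d \<le> 1 + d/10"
    and p: "norm p = 1" and \<epsilon>: "0 < \<epsilon>" and G: "G_solution d A \<epsilon> p G"
  shows "cell_flow_solution d A p (rescale \<epsilon> G)"
proof
  have "1 < A * d"
    using Ad d by (smt (verit) real_sqrt_ge_1_iff zero_le_power2)
  show "19 < A"
  proof (rule ccontr)
    assume "\<not> 19 < A"
    then have "A * d \<le> 19 * (20/399)" using d by (intro mult_mono) auto
    then show False using \<open>1 < A * d\<close> by simp
  qed
  show "d * A \<le> 101/100" using Ad(2) d by (simp add: mult.commute)
  have cont: "continuous_on spacetime G"
    and sol: "viscosity_subsolution (strain_hamiltonian (\<epsilon> * d) (VA_scaled A \<epsilon>)) G"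
      "viscosity_supersolution (strain_hamiltonian (\<epsilon> * d) (VA_scaled A \<epsilon>)) G"
    and init: "\<And>x. G (x, 0) = p \<bullet> x"
    and per: "\<And>(k::int^2) x t. 0 \<le> t \<Longrightarrow>
      G (x + (2 * pi * \<epsilon>) *\<^sub>R (\<chi> i. of_int (k$i)), t) - p \<bullet> (x + (2 * pi * \<epsilon>) *\<^sub>R (\<chi> i. of_int (k$i)))
      = G (x, t) - p \<bullet> x"
    using G by (auto simp: G_solution_def viscosity_solution_def Let_def)
  show "continuous_on spacetime (rescale \<epsilon> G)" by (rule continuous_on_rescale[OF \<epsilon> cont])
  have H: "(\<lambda>x. strain_hamiltonian (\<epsilon> * d) (VA_scaled A \<epsilon>) (\<epsilon> *\<^sub>R x)) = cell_hamiltonian d A"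
    using strain_hamiltonian_VA_scaled[OF \<epsilon>] by (simp add: fun_eq_iff)
  show "viscosity_subsolution (cell_hamiltonian d A) (rescale \<epsilon> G)"
    "viscosity_supersolution (cell_hamiltonian d A) (rescale \<epsilon> G)"
    using viscosity_subsolution_rescale[OF \<epsilon> sol(1) cont] viscosity_supersolution_rescale[OF \<epsilon> sol(2) cont]
    unfolding H .
  show "rescale \<epsilon> G (x, 0) = p \<bullet> x" for x using \<epsilon> by (simp add: rescale_def init)
  show "rescale \<epsilon> G (x + (2 * pi) *\<^sub>R (\<chi> i. of_int (k$i)), t)
      = rescale \<epsilon> G (x, t) + p \<bullet> ((2 * pi) *\<^sub>R (\<chi> i. of_int (k$i)))" if "0 \<le> t" for x and k :: "int^2" and t
  proof -
    let ?k = "(\<chi> i. of_int (k$i)) :: real^2"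
    have "G (\<epsilon> *\<^sub>R (x + (2 * pi) *\<^sub>R ?k), \<epsilon> * t) = G (\<epsilon> *\<^sub>R x, \<epsilon> * t) + \<epsilon> * (p \<bullet> ((2 * pi) *\<^sub>R ?k))"
      using per[of "\<epsilon> * t" "\<epsilon> *\<^sub>R x" k] \<epsilon> that
      by (simp add: scaleR_add_right inner_add_right algebra_simps)
    then show ?thesis using \<epsilon> by (simp add: rescale_def add_divide_distrib)
  qed
qed (use d Ad p in auto)

lemma saddle_edge_gap_scaled:
  assumes d: "0 < d" "d < 20/399" and Ad: "sqrt (1 + 4 * d\<^sup>2) < A * d" "A * d \<le> 1 + d/10"
    and p: "norm p = 1" and \<epsilon>: "0 < \<epsilon>" and G: "G_solution d A \<epsilon> p G" and t: "0 \<le> t"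
  shows "1/16 * (A / ln A) * t - \<epsilon> * (4 * pi + 1) \<le> G (\<epsilon> *\<^sub>R x_s, t) - G (\<epsilon> *\<^sub>R x_f, t)"
proof -
  interpret cell_flow_solution d A p "rescale \<epsilon> G"
    by (rule cell_flow_solution_rescale[OF d Ad p \<epsilon> G])
  have "1/16 * (A / ln A) * (t / \<epsilon>) - (4 * pi + 1) \<le> (G (\<epsilon> *\<^sub>R x_s, t) - G (\<epsilon> *\<^sub>R x_f, t)) / \<epsilon>"
    using saddle_edge_gap[of "t / \<epsilon>"] t \<epsilon> by (simp add: rescale_def diff_divide_distrib)
  from this[unfolded pos_le_divide_eq[OF \<epsilon>]]
  have "(1/16 * (A / ln A) * (t / \<epsilon>) - (4 * pi + 1)) * \<epsilon> \<le> G (\<epsilon> *\<^sub>R x_s, t) - G (\<epsilon> *\<^sub>R x_f, t)" .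
  also have "(1/16 * (A / ln A) * (t / \<epsilon>) - (4 * pi + 1)) * \<epsilon> = 1/16 * (A / ln A) * t - \<epsilon> * (4 * pi + 1)"
    using \<epsilon> by (simp add: left_diff_distrib)
  finally show ?thesis .
qed

lemma uniform_limit_along:
  fixes l :: "'a::topological_space \<Rightarrow> 'b::metric_space"
  assumes unif: "uniform_limit K f l F" and l: "continuous_on K l"
    and y: "(y \<longlongrightarrow> y0) F" and yK: "\<forall>\<^sub>F j in F. y j \<in> K" and "y0 \<in> K"
  shows "((\<lambda>j. f j (y j)) \<longlongrightarrow> l y0) F"
proof (rule tendstoI)
  fix e :: real assume "0 < e"
  have "((\<lambda>j. l (y j)) \<longlongrightarrow> l y0) F"
    by (rule continuous_on_tendsto_compose[OF l y \<open>y0 \<in> K\<close> yK])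
  then have "\<forall>\<^sub>F j in F. dist (l (y j)) (l y0) < e/2"
    using \<open>0 < e\<close> by (intro tendstoD) auto
  moreover have "\<forall>\<^sub>F j in F. \<forall>x\<in>K. dist (f j x) (l x) < e/2"
    using unif \<open>0 < e\<close> by (intro uniform_limitD) auto
  ultimately show "\<forall>\<^sub>F j in F. dist (f j (y j)) (l y0) < e"
    using yK
  proof eventually_elim
    case (elim j)
    have "dist (f j (y j)) (l y0) \<le> dist (f j (y j)) (l (y j)) + dist (l (y j)) (l y0)"
      by (rule dist_triangle)
    with elim show ?case by (smt (verit, best) field_sum_of_halves)
  qed
qed

text \<open>
  Values at two points merging at the origin cannot stay apart along a locally uniformly convergent sequence.
\<close>

lemma no_locally_uniform_limit:
  fixes f :: "nat \<Rightarrow> (real^2) \<times> real \<Rightarrow> real"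
  assumes cont: "\<And>j. continuous_on spacetime (f j)"
    and e: "e \<longlonglongrightarrow> 0" and t: "0 < t" and \<delta>: "0 < \<delta>"
    and gap: "\<And>j. \<delta> - e j * C \<le> f j (e j *\<^sub>R y, t) - f j (e j *\<^sub>R z, t)"
  shows "\<not> locally_uniform_limit spacetime f l sequentially"
proof
  assume lim: "locally_uniform_limit spacetime f l sequentially"
  define K :: "((real^2) \<times> real) set" where "K = cball 0 1 \<times> {t}"
  have K: "compact K" "K \<subseteq> spacetime"
    using t by (auto simp: K_def spacetime_def intro: compact_Times)
  then have unif: "uniform_limit K f l sequentially"
    using lim by (auto simp: locally_uniform_limit_def)
  have "continuous_on K l"
    using continuous_on_subset[OF cont K(2)]
    by (intro uniform_limit_theorem[OF _ unif]) auto
  have pt: "(\<lambda>j. f j (e j *\<^sub>R y, t)) \<longlonglongrightarrow> l (0, t)" for y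
  proof (rule uniform_limit_along[OF unif \<open>continuous_on K l\<close>])
    have "(\<lambda>j. e j *\<^sub>R y) \<longlonglongrightarrow> 0 *\<^sub>R y" by (intro tendsto_intros e)
    then have 0: "(\<lambda>j. e j *\<^sub>R y) \<longlonglongrightarrow> 0" by simp
    then show "(\<lambda>j. (e j *\<^sub>R y, t)) \<longlonglongrightarrow> (0, t)" by (intro tendsto_intros)
    have "\<forall>\<^sub>F j in sequentially. dist (e j *\<^sub>R y) 0 < 1" using 0 by (rule tendstoD) simp
    then show "\<forall>\<^sub>F j in sequentially. (e j *\<^sub>R y, t) \<in> K"
      by eventually_elim (simp add: K_def)
  qed (simp add: K_def)
  have "(\<lambda>j. \<delta> - e j * C) \<longlonglongrightarrow> \<delta> - 0 * C" by (intro tendsto_intros e)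
  moreover have "(\<lambda>j. f j (e j *\<^sub>R y, t) - f j (e j *\<^sub>R z, t)) \<longlonglongrightarrow> l (0, t) - l (0, t)"
    by (intro tendsto_diff pt)
  ultimately have "\<delta> - 0 * C \<le> l (0, t) - l (0, t)"
    using gap by (intro LIMSEQ_le) auto
  with \<delta> show False by simp
qed

theorem corollary2p3:
  shows "\<exists>C::real. C > 0 \<and>
    (\<forall>(d::real) (A::real) (p::real^2) (G :: real \<Rightarrow> (real^2) \<times> real \<Rightarrow> real).
       0 < d \<and> d < 20/399 \<and> sqrt (1 + 4 * d\<^sup>2) < A * d \<and> A * d \<le> 1 + d/10 \<and>
       norm p = 1 \<and>
       (\<forall>\<epsilon>>0. G_solution d A \<epsilon> p (G \<epsilon>))
       \<longrightarrow>
       (\<forall>t\<^sub>0>0. Liminf (at_right 0)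
                  (\<lambda>\<epsilon>. ereal (G \<epsilon> (\<epsilon> *\<^sub>R x_s, t\<^sub>0) - G \<epsilon> (\<epsilon> *\<^sub>R x_f, t\<^sub>0)))
                \<ge> ereal (C * (A / ln A) * t\<^sub>0)) \<and>
       (\<forall>\<epsilon>>0. norm (\<epsilon> *\<^sub>R x_s - \<epsilon> *\<^sub>R x_f) = pi / 2 * \<epsilon>) \<and>
       \<not> (\<exists>(e :: nat \<Rightarrow> real) Glim. (\<forall>j. e j > 0) \<and> e \<longlonglongrightarrow> 0 \<and>
            locally_uniform_limit spacetime (\<lambda>j. G (e j)) Glim sequentially) \<and>
       \<not> (\<exists>(Hbar :: real^2 \<Rightarrow> real) Gbar.
            viscosity_solution (\<lambda>x q. Hbar q) Gbar \<and>
            (\<forall>x. Gbar (x, 0) = p \<bullet> x) \<and>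
            locally_uniform_limit spacetime G Gbar (at_right 0)))"
proof (rule exI[of _ "1/16"], rule conjI, simp, intro allI impI)
  fix d A :: real and p :: "real^2" and G :: "real \<Rightarrow> (real^2) \<times> real \<Rightarrow> real"
  assume "0 < d \<and> d < 20/399 \<and> sqrt (1 + 4 * d\<^sup>2) < A * d \<and> A * d \<le> 1 + d/10 \<and>
       norm p = 1 \<and> (\<forall>\<epsilon>>0. G_solution d A \<epsilon> p (G \<epsilon>))"
  then have d: "0 < d" "d < 20/399" and Ad: "sqrt (1 + 4 * d\<^sup>2) < A * d" "A * d \<le> 1 + d/10"
    and p: "norm p = 1" and G: "\<And>\<epsilon>. 0 < \<epsilon> \<Longrightarrow> G_solution d A \<epsilon> p (G \<epsilon>)" by auto
  note gap = saddle_edge_gap_scaled[OF d Ad p _ G]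
  have "19 < A"
    by (rule cell_flow_solution.A_gt[OF cell_flow_solution_rescale[OF d Ad p zero_less_one G[OF zero_less_one]]])
  then have pos: "0 < 1/16 * (A / ln A) * 1" by simp
  have liminf: "ereal (1/16 * (A / ln A) * t) \<le> Liminf (at_right 0)
      (\<lambda>\<epsilon>. ereal (G \<epsilon> (\<epsilon> *\<^sub>R x_s, t) - G \<epsilon> (\<epsilon> *\<^sub>R x_f, t)))" if "0 < t" for t
  proof -
    have "((\<lambda>\<epsilon>. 1/16 * (A / ln A) * t - \<epsilon> * (4 * pi + 1)) \<longlongrightarrow>
        1/16 * (A / ln A) * t - 0 * (4 * pi + 1)) (at_right 0)"
      by (intro tendsto_intros)
    then have "((\<lambda>\<epsilon>. ereal (1/16 * (A / ln A) * t - \<epsilon> * (4 * pi + 1))) \<longlongrightarrow>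
        ereal (1/16 * (A / ln A) * t)) (at_right 0)" by simp
    then have "ereal (1/16 * (A / ln A) * t)
        = Liminf (at_right 0) (\<lambda>\<epsilon>. ereal (1/16 * (A / ln A) * t - \<epsilon> * (4 * pi + 1)))"
      by (rule lim_imp_Liminf[symmetric, rotated]) simp
    also have "\<dots> \<le> Liminf (at_right 0) (\<lambda>\<epsilon>. ereal (G \<epsilon> (\<epsilon> *\<^sub>R x_s, t) - G \<epsilon> (\<epsilon> *\<^sub>R x_f, t)))"
    proof (rule Liminf_mono)
      show "\<forall>\<^sub>F \<epsilon> in at_right 0. ereal (1/16 * (A / ln A) * t - \<epsilon> * (4 * pi + 1))
          \<le> ereal (G \<epsilon> (\<epsilon> *\<^sub>R x_s, t) - G \<epsilon> (\<epsilon> *\<^sub>R x_f, t))"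
        unfolding eventually_at_filter ereal_less_eq(3)
        by (rule always_eventually) (use gap that in simp)
    qed
    finally show ?thesis .
  qed
  have distance: "norm (\<epsilon> *\<^sub>R x_s - \<epsilon> *\<^sub>R x_f) = pi / 2 * \<epsilon>" if "0 < \<epsilon>" for \<epsilon>
  proof -
    have "x_s - x_f = vector [pi/2, 0]" by (simp add: x_s_def x_f_def vec_eq_iff forall_2)
    then have "norm (x_s - x_f) = pi/2" by (simp add: norm_eq_sqrt_inner inner_vec2 real_sqrt_divide)
    then show ?thesis using that by (simp flip: scaleR_diff_right)
  qed
  have nolim: "\<not> locally_uniform_limit spacetime (\<lambda>j. G (e j)) l sequentially"
    if e: "\<And>j. 0 < e j" "e \<longlonglongrightarrow> 0" for e :: "nat \<Rightarrow> real" and l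
  proof (rule no_locally_uniform_limit[OF _ e(2) zero_less_one pos])
    show "continuous_on spacetime (G (e j))" for j
      using G[OF e(1)] by (simp add: G_solution_def)
    show "1/16 * (A / ln A) * 1 - e j * (4 * pi + 1) \<le> G (e j) (e j *\<^sub>R x_s, 1) - G (e j) (e j *\<^sub>R x_f, 1)" for j
      by (rule gap) (use e in auto)
  qed
  have "\<not> locally_uniform_limit spacetime G l (at_right 0)" for l
  proof
    assume lim: "locally_uniform_limit spacetime G l (at_right 0)"
    define e where "e = (\<lambda>j. inverse (real (Suc j)))"
    have e: "e \<longlonglongrightarrow> 0" unfolding e_def by (rule LIMSEQ_inverse_real_of_nat)
    have e_pos: "0 < e j" for j by (simp add: e_def)
    have "e j \<in> {0<..} \<and> e j \<noteq> 0" for j using e_pos[of j] by simp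
    then have "filterlim e (at_right 0) sequentially"
      using e unfolding filterlim_at by (intro conjI always_eventually) auto
    then have "locally_uniform_limit spacetime (\<lambda>j. G (e j)) l sequentially"
      using lim unfolding locally_uniform_limit_def by (blast intro: filterlim_compose)
    with nolim[OF e_pos e] show False by blast
  qed
  with liminf distance nolim
  show "(\<forall>t\<^sub>0>0. Liminf (at_right 0)
                  (\<lambda>\<epsilon>. ereal (G \<epsilon> (\<epsilon> *\<^sub>R x_s, t\<^sub>0) - G \<epsilon> (\<epsilon> *\<^sub>R x_f, t\<^sub>0)))
                \<ge> ereal (1/16 * (A / ln A) * t\<^sub>0)) \<and>
       (\<forall>\<epsilon>>0. norm (\<epsilon> *\<^sub>R x_s - \<epsilon> *\<^sub>R x_f) = pi / 2 * \<epsilon>) \<and>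
       \<not> (\<exists>(e :: nat \<Rightarrow> real) Glim. (\<forall>j. e j > 0) \<and> e \<longlonglongrightarrow> 0 \<and>
            locally_uniform_limit spacetime (\<lambda>j. G (e j)) Glim sequentially) \<and>
       \<not> (\<exists>(Hbar :: real^2 \<Rightarrow> real) Gbar.
            viscosity_solution (\<lambda>x q. Hbar q) Gbar \<and>
            (\<forall>x. Gbar (x, 0) = p \<bullet> x) \<and>
            locally_uniform_limit spacetime G Gbar (at_right 0))"
    by blast
qed

end
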